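(* Let $\nu$ be a $\sigma$-finite positive Radon measure on $\mathbb{R}$ (atoms are allowed). Then $$ N_-(\mathcal{E}_{\mathbb{R},\nu})\le 1+5.06\sum_{\{n\in\mathbb{Z}:\ \mathcal{A}_n>0.092\}}\sqrt{\mathcal{A}_n}. $$
   Context: The form is $\mathcal{E}_{\mathbb{R},\nu}[u]=\int_{\mathbb{R}}|u'(x)|^2dx-\int_{\mathbb{R}}|u(x)|^2d\nu(x)$ with domain $W^1_2(\mathbb{R})\cap L^2(\mathbb{R},d\nu)$ (elements of $W^1_2(\mathbb{R})$ are identified with their continuous representatives). $N_-(\mathbf{q})$ is the supremum of $\dim\mathcal{L}$ over linear subspaces $\mathcal{L}\subseteq\mathrm{Dom}(\mathbf{q})$ with $\mathbf{q}[u]<0$ for all $u\in\mathcal{L}\setminus\{0\}$. Let $I_n=[2^{n-1},2^n]$ for $n>0$, $I_0=[-1,1]$, $I_n=[-2^{|n|},-2^{|n|-1}]$ for $n<0$, and $\mathcal{A}_n=\int_{I_n}|x|\,d\nu(x)$ for $n\neq0$, $\mathcal{A}_0=\int_{I_0}d\nu(x)$. *)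

theory Defs
  imports "HOL-Analysis.Analysis" "HOL-Library.Function_Algebras"
begin

definition radon_measure :: "real measure \<Rightarrow> bool" where
  "radon_measure \<nu> \<longleftrightarrow> sets \<nu> = sets borel \<and>
     (\<forall>K. compact K \<longrightarrow> emeasure \<nu> K < \<infinity>) \<and>
     (\<forall>A\<in>sets borel. emeasure \<nu> A = (SUP K\<in>{K. compact K \<and> K \<subseteq> A}. emeasure \<nu> K))"

interpretation cfun: vector_space "\<lambda>(c::complex) (u::real \<Rightarrow> complex) x. c * u x"
  by unfold_locales (auto simp: fun_eq_iff algebra_simps)

definition L2 :: "real measure \<Rightarrow> (real \<Rightarrow> complex) set" where
  "L2 M = {u \<in> borel_measurable M. integrable M (\<lambda>x. (cmod (u x))\<^sup>2)}"

definition test_function :: "(real \<Rightarrow> real) \<Rightarrow> bool" where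
  "test_function \<phi> \<longleftrightarrow> (\<forall>k. (deriv ^^ k) \<phi> differentiable_on UNIV) \<and>
     compact (closure {x. \<phi> x \<noteq> 0})"

definition is_weak_deriv :: "(real \<Rightarrow> complex) \<Rightarrow> (real \<Rightarrow> complex) \<Rightarrow> bool" where
  "is_weak_deriv u g \<longleftrightarrow> (\<forall>\<phi>. test_function \<phi> \<longrightarrow>
     (LINT x|lborel. deriv \<phi> x *\<^sub>R u x) = - (LINT x|lborel. \<phi> x *\<^sub>R g x))"

text \<open>The Sobolev space \<open>W\<^sup>1\<^sub>2(\<real>)\<close>, each class being represented by its unique
  continuous element.\<close>

definition W12 :: "(real \<Rightarrow> complex) set" where
  "W12 = {u. continuous_on UNIV u \<and> u \<in> L2 lborel \<and> (\<exists>g\<in>L2 lborel. is_weak_deriv u g)}"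

text \<open>The choice is determined only up to a Lebesgue null set, which the form below does
  not see.\<close>

definition weak_deriv :: "(real \<Rightarrow> complex) \<Rightarrow> real \<Rightarrow> complex" where
  "weak_deriv u = (SOME g. g \<in> L2 lborel \<and> is_weak_deriv u g)"

definition form_dom :: "real measure \<Rightarrow> (real \<Rightarrow> complex) set" where
  "form_dom \<nu> = W12 \<inter> L2 \<nu>"

definition form :: "real measure \<Rightarrow> (real \<Rightarrow> complex) \<Rightarrow> real" where
  "form \<nu> u = (LINT x|lborel. (cmod (weak_deriv u x))\<^sup>2) - (LINT x|\<nu>. (cmod (u x))\<^sup>2)"

text \<open>The library's \<open>dim\<close> is only meaningful for finite-dimensional spaces (it is natural-number
  valued), so infinite dimension is treated separately.\<close>

definition edim :: "(real \<Rightarrow> complex) set \<Rightarrow> enat" where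
  "edim L = (if \<exists>B. finite B \<and> L \<subseteq> cfun.span B then enat (cfun.dim L) else \<infinity>)"

definition N_minus :: "(real \<Rightarrow> complex) set \<Rightarrow> ((real \<Rightarrow> complex) \<Rightarrow> real) \<Rightarrow> enat" where
  "N_minus D q = (SUP L\<in>{L. cfun.subspace L \<and> L \<subseteq> D \<and> (\<forall>u\<in>L - {0}. q u < 0)}. edim L)"

definition dyadic :: "int \<Rightarrow> real set" where
  "dyadic n = (if n > 0 then {2 powi (n - 1)..2 powi n}
          else if n = 0 then {-1..1}
          else {- (2 powi \<bar>n\<bar>)..- (2 powi (\<bar>n\<bar> - 1))})"

text \<open>For a Radon measure these integrals over compact intervals are finite.\<close>

definition \<A> :: "real measure \<Rightarrow> int \<Rightarrow> real" where
  "\<A> \<nu> n = (if n = 0 then (LINT x:dyadic 0|\<nu>. 1) else (LINT x:dyadic n|\<nu>. \<bar>x\<bar>))"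

end

theory Submission
  imports Defs
begin

text \<open>
  The idea is to find a finite set \<open>T\<close> of points such that \<open>form \<nu> u\<close> is nonnegative for every
  \<open>u\<close> in the form domain that vanishes on \<open>T\<close>.  Then a subspace on which the form is negative
  meets the common kernel of \<open>card T\<close> evaluation functionals only in \<open>0\<close>, so that
  \<open>N_minus \<le> card T\<close> (\<open>N_minus_le_card\<close>); it remains to choose \<open>T\<close> economically.

  All that is used about the Dirichlet integral is that, with \<open>G\<close> the distribution function of
  the measure \<open>|u'|\<^sup>2 dx\<close>, increments satisfy \<open>|u y - u x|\<^sup>2 \<le> (y - x) (G y - G x)\<close>
  (\<open>W12_energy\<close>).  For a weak derivative this follows by testing with smooth approximations
  of the indicator of \<open>(x, y]\<close>.

  One point of \<open>T\<close> is \<open>0\<close>, which separates the two half-lines; the left one is the reflection of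
  the right one.  On the right half-line the claim is proved in the telescoping form
  \<open>\<integral>\<^bsub>(0,b]\<^esub> |u|\<^sup>2 d\<nu> + |u b|\<^sup>2 / (2 b) \<le> G b - G 0\<close> for \<open>b = 2 ^ m\<close>, one octave \<open>[a, 2 a]\<close> at a time.
  The boundary term \<open>|u b|\<^sup>2 / (2 b)\<close>, which is the one of Hardy's inequality, is what lets octaves
  of small moment be passed without spending any point: on \<open>[a, 2 a]\<close> one has
  \<open>|u x|\<^sup>2 / (6 x) \<le> G (2 a) - G a + |u a|\<^sup>2 / (2 a) - |u (2 a)|\<^sup>2 / (4 a)\<close>
  (\<open>octave_pointwise\<close>), and integrating this against \<open>\<nu>\<close> closes the step whenever
  \<open>\<integral> |x| d\<nu> \<le> 1/6\<close>, in particular when it is at most \<open>0.092\<close> (\<open>octave_small\<close>).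

  An octave of larger moment \<open>A\<close> is given its left end point, which restarts the argument with
  boundary value \<open>0\<close>, and then points chosen greedily so that on the open interval between
  neighbours length times mass is at most \<open>1/2\<close>, while including the right end point makes it at
  least \<open>1/2\<close>.  The square root of length times mass is superadditive under subdivision, so at most
  \<open>\<lfloor>sqrt (2 A)\<rfloor>\<close> such points occur (\<open>greedy_zeros\<close>).  An octave thus costs at most
  \<open>1 + sqrt (2 A)\<close> points, and \<open>1 + sqrt (2 A) \<le> 5.06 sqrt A\<close> for \<open>A > 0.092\<close>.  The intervals \<open>(0, 1]\<close>
  and \<open>[-1, 0)\<close> start at the zero \<open>0\<close> and need only the greedy points, which are absent
  if their mass is at most \<open>0.092\<close>.
\<close>

section \<open>Counting negative directions by evaluation functionals\<close>

text \<open>The evaluations at the points of \<open>T\<close> are jointly injective on \<open>L\<close>; each of them lowers the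
  dimension by at most one.  The result is put as a spanning set because this is
  what decides between the two cases of \<open>edim\<close>.\<close>

lemma subspace_span_card:
  assumes "finite T" and "cfun.subspace L"
    and "\<And>u. u \<in> L \<Longrightarrow> (\<And>t. t \<in> T \<Longrightarrow> u t = 0) \<Longrightarrow> u = 0"
  shows "\<exists>B. finite B \<and> card B \<le> card T \<and> L \<subseteq> cfun.span B"
  using assms
proof (induction T arbitrary: L rule: finite_induct)
  case empty
  then have "L \<subseteq> cfun.span {}" unfolding cfun.span_empty by (auto simp: zero_fun_def)
  then show ?case by (metis card.empty finite.emptyI order_refl)
next
  case (insert t T)
  note sub = insert.prems(1)
  show ?case
  proof (cases "\<forall>u\<in>L. u t = 0")
    case True
    then have "\<exists>B. finite B \<and> card B \<le> card T \<and> L \<subseteq> cfun.span B"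
      using insert.prems by (intro insert.IH) auto
    then show ?thesis using insert.hyps by (auto intro: le_SucI)
  next
    case False
    then obtain v where v: "v \<in> L" "v t \<noteq> 0" by auto
    define w where "w = (\<lambda>x. inverse (v t) * v x)"
    have w: "w \<in> L" "w t = 1"
      using v cfun.subspace_scale[OF sub v(1), of "inverse (v t)"] by (auto simp: w_def)
    define L' where "L' = {u\<in>L. u t = 0}"
    have "cfun.subspace L'"
      using cfun.subspace_0[OF sub] cfun.subspace_add[OF sub] cfun.subspace_scale[OF sub]
      by (auto simp: L'_def cfun.subspace_def)
    then have "\<exists>B. finite B \<and> card B \<le> card T \<and> L' \<subseteq> cfun.span B"
      using insert.prems by (intro insert.IH) (auto simp: L'_def)
    then obtain B where B: "finite B" "card B \<le> card T" "L' \<subseteq> cfun.span B" by auto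
    have "u \<in> cfun.span (insert w B)" if u: "u \<in> L" for u
    proof -
      let ?w = "\<lambda>x. u t * w x"
      have wL: "?w \<in> L" using cfun.subspace_scale[OF sub w(1)] .
      have "u - ?w \<in> L'" using cfun.subspace_diff[OF sub u wL] w by (auto simp: L'_def)
      then have "u - ?w \<in> cfun.span (insert w B)"
        using B(3) cfun.span_mono[of B "insert w B"] by blast
      moreover have "?w \<in> cfun.span (insert w B)"
        by (intro cfun.span_scale cfun.span_base) auto
      ultimately have "(u - ?w) + ?w \<in> cfun.span (insert w B)"
        by (rule cfun.span_add)
      then show ?thesis by simp
    qed
    moreover have "card (insert w B) \<le> card (insert t T)"
      using B insert.hyps by (simp add: card_insert_if)
    ultimately show ?thesis using B(1) by (intro exI[of _ "insert w B"]) auto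
  qed
qed

lemma N_minus_le_card:
  assumes "finite T"
    and nonneg: "\<And>u. u \<in> D \<Longrightarrow> (\<And>t. t \<in> T \<Longrightarrow> u t = 0) \<Longrightarrow> 0 \<le> q u"
  shows "N_minus D q \<le> enat (card T)"
  unfolding N_minus_def
proof (rule SUP_least)
  fix L assume "L \<in> {L. cfun.subspace L \<and> L \<subseteq> D \<and> (\<forall>u\<in>L - {0}. q u < 0)}"
  then have L: "cfun.subspace L" "L \<subseteq> D" "\<And>u. u \<in> L \<Longrightarrow> u \<noteq> 0 \<Longrightarrow> q u < 0" by auto
  have "u = 0" if "u \<in> L" "\<And>t. t \<in> T \<Longrightarrow> u t = 0" for u
    using L(2,3) nonneg[of u] that by force
  then obtain B where B: "finite B" "card B \<le> card T" "L \<subseteq> cfun.span B"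
    using subspace_span_card[OF assms(1) L(1)] by blast
  have "cfun.dim L \<le> card T"
    using cfun.dim_le_card[OF B(3,1)] B(2) by simp
  then show "edim L \<le> enat (card T)"
    using B by (auto simp: edim_def)
qed

section \<open>Smooth step functions\<close>

text \<open>The powers in the denominator make the family closed under differentiation up to linear
  combinations, so smoothness of \<open>exp (- 1 / t)\<close> at \<open>0\<close> needs only one limit for each \<open>k\<close>.\<close>

definition flat :: "nat \<Rightarrow> real \<Rightarrow> real" where
  "flat k t = (if t > 0 then exp (- (1 / t)) / t ^ k else 0)"

lemma flat_at_right: "(flat k \<longlongrightarrow> 0) (at_right 0)"
proof -
  have "((\<lambda>x::real. x ^ k / exp x) \<longlongrightarrow> 0) at_top" by (rule tendsto_power_div_exp_0)
  moreover have "\<forall>\<^sub>F x::real in at_top. x ^ k / exp x = flat k (inverse x)"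
    using eventually_gt_at_top[of "0::real"]
    by eventually_elim (simp add: flat_def exp_minus field_simps power_inverse)
  ultimately have "((\<lambda>x. flat k (inverse x)) \<longlongrightarrow> 0) at_top"
    using tendsto_cong by force
  then show ?thesis by (simp add: filterlim_at_right_to_top)
qed

lemma flat_deriv:
  "(flat k has_real_derivative flat (k + 2) t - k * flat (k + 1) t) (at t)"
proof -
  consider "t < 0" | "t = 0" | "t > 0" by linarith
  then show ?thesis
  proof cases
    case 1
    have "((\<lambda>_. 0) has_real_derivative flat (k + 2) t - k * flat (k + 1) t) (at t)"
      using 1 by (simp add: flat_def)
    then show ?thesis
      by (rule has_field_derivative_transform_within_open[where S = "{..<0}"])
         (use 1 in \<open>auto simp: flat_def\<close>)
  next
    case 2
    have "((\<lambda>h. flat k h / h) \<longlongrightarrow> 0) (at_right 0)"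
    proof (rule Lim_transform_eventually[OF flat_at_right[of "k + 1"]])
      show "\<forall>\<^sub>F h in at_right 0. flat (k + 1) h = flat k h / h"
        by (auto simp: flat_def eventually_at_filter)
    qed
    moreover have "((\<lambda>h. flat k h / h) \<longlongrightarrow> 0) (at_left 0)"
    proof (rule Lim_transform_eventually[OF tendsto_const])
      show "\<forall>\<^sub>F h in at_left 0. 0 = flat k h / h"
        by (auto simp: flat_def eventually_at_filter)
    qed
    ultimately have "((\<lambda>h. flat k h / h) \<longlongrightarrow> 0) (at 0)"
      by (simp add: filterlim_at_split)
    then show ?thesis
      using 2 by (simp add: has_field_derivative_iff flat_def)
  next
    case 3
    have "((\<lambda>t. exp (- (1 / t)) / t ^ k) has_real_derivative flat (k + 2) t - k * flat (k + 1) t) (at t)"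
      using 3
      by (auto intro!: derivative_eq_intros simp: flat_def field_simps power2_eq_square)
         (cases k; simp add: field_simps)
    then show ?thesis
      by (rule has_field_derivative_transform_within_open[where S = "{0<..}"])
         (use 3 in \<open>auto simp: flat_def\<close>)
  qed
qed

text \<open>A class of functions that is closed under differentiation consists of smooth functions.
  The products are supported in \<open>[0, 1]\<close>; the closure rules admit their derivatives and the
  derivatives of translated and rescaled steps.\<close>

inductive_set bumps :: "(real \<Rightarrow> real) set" where
  bump: "(\<lambda>t. flat j t * flat k (1 - t)) \<in> bumps"
| add: "f \<in> bumps \<Longrightarrow> g \<in> bumps \<Longrightarrow> (\<lambda>t. f t + g t) \<in> bumps"
| affine: "f \<in> bumps \<Longrightarrow> (\<lambda>t. c * f (m * t + d)) \<in> bumps"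

lemma bumps_scale: "f \<in> bumps \<Longrightarrow> (\<lambda>t. c * f t) \<in> bumps"
  using bumps.affine[of f c 1 0] by simp

lemma bumps_deriv:
  "f \<in> bumps \<Longrightarrow> \<exists>f'\<in>bumps. \<forall>t. (f has_real_derivative f' t) (at t)"
proof (induction rule: bumps.induct)
  case (bump j k)
  let ?b = "\<lambda>j k t. flat j t * flat k (1 - t)"
  let ?f = "\<lambda>t. (?b (j + 2) k t + (- real j) * ?b (j + 1) k t)
     + ((-1) * ?b j (k + 2) t + real k * ?b j (k + 1) t)"
  have "?f \<in> bumps" by (intro bumps.add bumps.bump bumps_scale)
  moreover have "((\<lambda>t. flat j t * flat k (1 - t)) has_real_derivative ?f t) (at t)" for t
  proof -
    have "((\<lambda>t. flat k (1 - t)) has_real_derivative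
        (flat (k + 2) (1 - t) - k * flat (k + 1) (1 - t)) * (-1)) (at t)"
      by (rule DERIV_chain2[OF flat_deriv]) (auto intro!: derivative_eq_intros)
    from DERIV_mult[OF flat_deriv[of j t] this] show ?thesis
      by (rule DERIV_cong) (simp add: algebra_simps)
  qed
  ultimately show ?case by (intro bexI[of _ ?f]) auto
next
  case (add f g)
  then obtain f' g' where "f' \<in> bumps" "g' \<in> bumps"
    "\<forall>t. (f has_real_derivative f' t) (at t)" "\<forall>t. (g has_real_derivative g' t) (at t)" by blast
  then show ?case
    by (intro bexI[of _ "\<lambda>t. f' t + g' t"]) (auto intro: bumps.add DERIV_add)
next
  case (affine f c m d)
  then obtain f' where f': "f' \<in> bumps" "\<And>t. (f has_real_derivative f' t) (at t)" by blast
  have "((\<lambda>t. c * f (m * t + d)) has_real_derivative (c * m) * f' (m * t + d)) (at t)" for t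
    by (rule derivative_eq_intros DERIV_chain2[OF f'(2)] refl | simp)+
  then show ?case
    using bumps.affine[OF f'(1), of "c * m" m d]
    by (intro bexI[of _ "\<lambda>t. (c * m) * f' (m * t + d)"]) auto
qed

lemma bumps_iterated_deriv: "f \<in> bumps \<Longrightarrow> (deriv ^^ k) f \<in> bumps"
proof (induction k arbitrary: f)
  case (Suc k)
  obtain f' where f': "f' \<in> bumps" "\<And>t. (f has_real_derivative f' t) (at t)"
    using bumps_deriv[OF Suc.prems] by blast
  have "deriv f = f'" using f'(2) by (auto intro!: DERIV_imp_deriv)
  then show ?case using Suc.IH[OF f'(1)] by (simp add: funpow_swap1)
qed simp

lemma differentiable_bumps: "f \<in> bumps \<Longrightarrow> f differentiable_on UNIV"
  using bumps_deriv[of f]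
  by (auto simp: differentiable_on_def intro: differentiableI has_field_derivative_imp_has_derivative differentiable_at_withinI)

lemma isCont_bumps: "f \<in> bumps \<Longrightarrow> isCont f t"
  using bumps_deriv[of f] by (blast intro: DERIV_isCont)

lemma test_function_primitive:
  assumes "f \<in> bumps" and F: "\<And>t. (F has_real_derivative f t) (at t)"
    and supp: "\<And>t. t \<notin> {a..b} \<Longrightarrow> F t = 0"
  shows "test_function F"
  unfolding test_function_def
proof (intro conjI allI)
  fix k
  have dF: "deriv F = f" using F by (auto intro!: DERIV_imp_deriv)
  show "(deriv ^^ k) F differentiable_on UNIV"
  proof (cases k)
    case 0
    then show ?thesis using F
      by (auto simp: differentiable_on_def intro: differentiableI has_field_derivative_imp_has_derivative differentiable_at_withinI)
  next
    case (Suc n)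
    have "(deriv ^^ k) F = (deriv ^^ n) f" by (simp add: Suc funpow_swap1 dF)
    then show ?thesis
      using differentiable_bumps[OF bumps_iterated_deriv[OF assms(1)]] by simp
  qed
next
  have "{t. F t \<noteq> 0} \<subseteq> {a..b}" using supp by blast
  then show "compact (closure {t. F t \<noteq> 0})"
    by (meson bounded_closed_interval bounded_subset compact_closure)
qed

text \<open>The step is the normalised primitive of a bump supported in \<open>[0, 1]\<close>.\<close>

lemma smooth_step:
  obtains \<rho> H :: "real \<Rightarrow> real" where "\<rho> \<in> bumps"
    and "\<And>t. (H has_real_derivative \<rho> t) (at t)" and "\<And>t. 0 \<le> \<rho> t"
    and "\<And>t. t \<notin> {0..1} \<Longrightarrow> \<rho> t = 0"
    and "\<And>t. t \<le> 0 \<Longrightarrow> H t = 0" and "\<And>t. 1 \<le> t \<Longrightarrow> H t = 1"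
proof -
  define \<beta> where "\<beta> = (\<lambda>t. flat 0 t * flat 0 (1 - t))"
  have \<beta>b: "\<beta> \<in> bumps" unfolding \<beta>_def by (rule bumps.bump)
  have \<beta>0: "\<beta> t = 0" if "t \<notin> {0<..<1}" for t using that by (auto simp: \<beta>_def flat_def)
  have \<beta>pos: "\<beta> t > 0" if "t \<in> {0<..<1}" for t using that by (auto simp: \<beta>_def flat_def)
  have \<beta>nn: "\<beta> t \<ge> 0" for t by (auto simp: \<beta>_def flat_def)
  have cont: "continuous_on A \<beta>" for A
    using isCont_bumps[OF \<beta>b] by (simp add: continuous_at_imp_continuous_on)
  \<comment> \<open>Starting at \<open>-1\<close> keeps the point \<open>0\<close> in the interior of the interval of integration;
    to the left of \<open>-1\<close> the integral over the empty interval is \<open>0\<close>.\<close>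
  define K where "K t = integral {-1..t} \<beta>" for t
  have K: "(K has_real_derivative \<beta> t) (at t)" for t
  proof (cases "t > -1")
    case True
    have "(K has_real_derivative \<beta> t) (at t within {-1..t+1})"
      unfolding K_def using True by (intro integral_has_real_derivative cont) auto
    then show ?thesis using True by (simp add: at_within_Icc_at)
  next
    case False
    have "K s = 0" if "s < 0" for s
      unfolding K_def using that by (intro integral_unique has_integral_is_0) (auto intro!: \<beta>0)
    moreover have "((\<lambda>_. 0) has_real_derivative \<beta> t) (at t)" using False by (simp add: \<beta>0)
    ultimately show ?thesis using False
      by - (rule has_field_derivative_transform_within_open[where S = "{..<0}" and f = "\<lambda>_. 0"], auto)
  qed
  have K01: "K 0 < K 1"
  proof (rule DERIV_pos_imp_increasing_open[where f = K and a = 0 and b = 1])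
    show "\<exists>y. (K has_real_derivative y) (at x) \<and> 0 < y" if "0 < x" "x < 1" for x
      using K[of x] \<beta>pos[of x] that by auto
    show "continuous_on {0..1} K"
      using DERIV_isCont[OF K] by (simp add: continuous_at_imp_continuous_on)
  qed simp
  have Kconst: "K s = K t" if "s < t" "t \<le> 0 \<or> 1 \<le> s" for s t
  proof -
    have "\<exists>z>s. z < t \<and> K t - K s = (t - s) * \<beta> z"
      using MVT2[OF that(1), of K \<beta>] K by blast
    then obtain z where "z > s" "z < t" "K t - K s = (t - s) * \<beta> z" by blast
    then show ?thesis using that(2) \<beta>0[of z] by auto
  qed
  define c where "c = inverse (K 1 - K 0)"
  have c: "c > 0" using K01 by (simp add: c_def)
  show thesis
  proof
    show "(\<lambda>t. c * \<beta> t) \<in> bumps" using \<beta>b by (rule bumps_scale)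
    show "((\<lambda>t. c * (K t - K 0)) has_real_derivative c * \<beta> t) (at t)" for t
      by (rule derivative_eq_intros K refl | simp)+
    show "0 \<le> c * \<beta> t" for t using c \<beta>nn by simp
    show "c * \<beta> t = 0" if "t \<notin> {0..1}" for t using that \<beta>0[of t] by auto
    show "c * (K t - K 0) = 0" if "t \<le> 0" for t
      using Kconst[of t 0] that by (cases "t = 0") auto
    show "c * (K t - K 0) = 1" if "1 \<le> t" for t
      using Kconst[of 1 t] that K01 by (cases "t = 1") (auto simp: c_def)
  qed
qed

section \<open>Increments of Sobolev functions\<close>

lemma kernel_average:
  fixes u :: "real \<Rightarrow> complex"
  assumes "continuous_on UNIV u" and w: "has_bochner_integral lborel w (1::real)"
    and w0: "\<And>t. 0 \<le> w t" "\<And>t. t \<notin> {a..b} \<Longrightarrow> w t = 0"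
    and close: "\<And>t. t \<in> {a..b} \<Longrightarrow> cmod (u t - v) \<le> \<eta>"
  shows "integrable lborel (\<lambda>t. w t *\<^sub>R u t)"
    and "cmod ((LINT t|lborel. w t *\<^sub>R u t) - v) \<le> \<eta>"
proof -
  have iw: "integrable lborel w" and Iw: "(LINT t|lborel. w t) = 1"
    using w by (auto simp: has_bochner_integral_iff)
  have [measurable]: "u \<in> borel_measurable borel"
    using assms(1) by (rule borel_measurable_continuous_onI)
  have [measurable]: "w \<in> borel_measurable borel"
    using borel_measurable_integrable[OF iw] by simp
  have bound: "norm (w t *\<^sub>R (u t - v)) \<le> w t * \<eta>" for t
    using w0(1)[of t] w0(2)[of t] close[of t] by (cases "t \<in> {a..b}") (auto intro: mult_left_mono)
  have id: "integrable lborel (\<lambda>t. w t *\<^sub>R (u t - v))"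
  proof (rule Bochner_Integration.integrable_bound)
    show "integrable lborel (\<lambda>t. w t * \<eta>)" using iw by simp
    show "(\<lambda>t. w t *\<^sub>R (u t - v)) \<in> borel_measurable lborel" by simp
    show "AE t in lborel. norm (w t *\<^sub>R (u t - v)) \<le> norm (w t * \<eta>)"
      by (rule AE_I2) (rule order_trans[OF bound], simp only: real_norm_def abs_ge_self)
  qed
  have iv: "integrable lborel (\<lambda>t. w t *\<^sub>R v)" using iw by simp
  have eq: "w t *\<^sub>R u t = w t *\<^sub>R (u t - v) + w t *\<^sub>R v" for t by (simp add: algebra_simps)
  show "integrable lborel (\<lambda>t. w t *\<^sub>R u t)"
    unfolding eq using id iv by (rule Bochner_Integration.integrable_add)
  have "(LINT t|lborel. w t *\<^sub>R u t) - v = (LINT t|lborel. w t *\<^sub>R (u t - v))"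
    unfolding eq using Bochner_Integration.integral_add[OF id iv] iw Iw by simp
  also have "cmod \<dots> \<le> (LINT t|lborel. norm (w t *\<^sub>R (u t - v)))"
    by (rule integral_norm_bound)
  also have "\<dots> \<le> (LINT t|lborel. w t * \<eta>)"
    by (rule integral_mono) (use iw bound integrable_norm[OF id] in auto)
  also have "\<dots> = \<eta>" using iw Iw by simp
  finally show "cmod ((LINT t|lborel. w t *\<^sub>R u t) - v) \<le> \<eta>" .
qed

text \<open>Testing the weak derivative with a smooth function \<open>\<phi>\<close> that climbs from \<open>0\<close> to \<open>1\<close> on
  \<open>[x, x + \<epsilon>]\<close> and descends on \<open>[y - \<epsilon>, y]\<close> turns \<open>\<integral> \<phi>' u\<close> into the difference of two averages
  of \<open>u\<close>, near \<open>x\<close> and near \<open>y\<close>.  As \<open>\<phi>\<close> stays inside \<open>(x, y]\<close>, the bound is not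
  affected by \<open>\<epsilon>\<close>.\<close>

lemma weak_deriv_increment:
  assumes u: "continuous_on UNIV u" and g: "g \<in> borel_measurable lborel"
    and g1: "set_integrable lborel {x<..y} (\<lambda>t. cmod (g t))" and weak: "is_weak_deriv u g"
    and xy: "x < y"
  shows "cmod (u y - u x) \<le> (LINT t:{x<..y}|lborel. cmod (g t))"
proof (rule field_le_epsilon)
  fix e :: real assume "0 < e"
  define \<eta> where "\<eta> = e / 2"
  then have \<eta>: "\<eta> > 0" using \<open>0 < e\<close> by simp
  obtain H \<rho> where \<rho>: "\<rho> \<in> bumps" and H: "\<And>t. (H has_real_derivative \<rho> t) (at t)"
    and \<rho>0: "\<And>t. 0 \<le> \<rho> t" "\<And>t. t \<notin> {0..1} \<Longrightarrow> \<rho> t = 0"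
    and H0: "\<And>t. t \<le> 0 \<Longrightarrow> H t = 0" and H1: "\<And>t. 1 \<le> t \<Longrightarrow> H t = 1"
    by (rule smooth_step) blast
  have Hmono: "H s \<le> H t" if "s \<le> t" for s t
  proof (rule DERIV_nonneg_imp_nondecreasing[where f = H, OF that])
    show "\<exists>y. (H has_real_derivative y) (at x) \<and> 0 \<le> y" for x using H[of x] \<rho>0(1)[of x] by blast
  qed
  have H01: "0 \<le> H t" "H t \<le> 1" for t
    using Hmono[of "min t 0" t] H0[of "min t 0"] Hmono[of t "max t 1"] H1[of "max t 1"] by auto
  have "isCont u x" "isCont u y" using u by (auto simp: continuous_on_eq_continuous_at)
  then have "\<exists>d>0. \<forall>t. dist t x < d \<longrightarrow> dist (u t) (u x) < \<eta>" "\<exists>d>0. \<forall>t. dist t y < d \<longrightarrow> dist (u t) (u y) < \<eta>"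
    using \<eta> unfolding continuous_at_eps_delta by blast+
  then obtain d1 d2 where d: "d1 > 0" "d2 > 0"
    "\<And>t. dist t x < d1 \<Longrightarrow> dist (u t) (u x) < \<eta>" "\<And>t. dist t y < d2 \<Longrightarrow> dist (u t) (u y) < \<eta>"
    by blast
  define \<epsilon> where "\<epsilon> = Min {d1, d2, y - x} / 2"
  have \<epsilon>: "\<epsilon> > 0" "\<epsilon> < d1" "\<epsilon> < d2" "\<epsilon> < y - x"
    using d xy by (auto simp: \<epsilon>_def)
  define w where "w z t = (1 / \<epsilon>) * \<rho> ((1 / \<epsilon>) * t + (- z / \<epsilon>))" for z t
  have wb: "w z \<in> bumps" for z
    unfolding w_def by (rule bumps.affine[OF \<rho>])
  have DH: "((\<lambda>t. H ((1 / \<epsilon>) * t + (- z / \<epsilon>))) has_real_derivative w z t) (at t)" for z t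
  proof -
    have "((\<lambda>t. (1 / \<epsilon>) * t + (- z / \<epsilon>)) has_real_derivative 1 / \<epsilon>) (at t)"
      using \<epsilon> by (auto intro!: derivative_eq_intros)
    from DERIV_chain2[OF H this] show ?thesis by (simp add: w_def mult.commute)
  qed
  have w0: "0 \<le> w z t" for z t using \<rho>0(1) \<epsilon> by (simp add: w_def)
  have wsupp: "w z t = 0" if "t \<notin> {z..z + \<epsilon>}" for z t
  proof -
    have "(t - z) / \<epsilon> \<notin> {0..1}"
      using that \<epsilon> by (auto simp: zero_le_divide_iff divide_le_eq_1)
    then have "(1 / \<epsilon>) * t + (- z / \<epsilon>) \<notin> {0..1}" by (simp add: diff_divide_distrib)
    then show ?thesis unfolding w_def using \<rho>0(2) by simp
  qed
  have wint: "has_bochner_integral lborel (w z) 1" for z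
  proof -
    have "has_bochner_integral lborel (\<lambda>t. w z t * indicator {z..z + \<epsilon>} t)
       (H ((1 / \<epsilon>) * (z + \<epsilon>) + (- z / \<epsilon>)) - H ((1 / \<epsilon>) * z + (- z / \<epsilon>)))"
      by (rule has_bochner_integral_FTC_Icc_real)
         (use \<epsilon> DH w0 isCont_bumps[OF wb] in auto)
    moreover have "(\<lambda>t. w z t * indicator {z..z + \<epsilon>} t) = w z"
      using wsupp by (auto simp: fun_eq_iff indicator_def)
    moreover have "H ((1 / \<epsilon>) * (z + \<epsilon>) + (- z / \<epsilon>)) = 1" "H ((1 / \<epsilon>) * z + (- z / \<epsilon>)) = 0"
      using \<epsilon> H0 H1 by (simp_all add: add_divide_distrib)
    ultimately show ?thesis by simp
  qed
  define \<phi> where "\<phi> t = H ((1 / \<epsilon>) * t + (- x / \<epsilon>)) - H ((1 / \<epsilon>) * t + (- (y - \<epsilon>) / \<epsilon>))" for t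
  have D\<phi>: "(\<phi> has_real_derivative w x t + (-1) * w (y - \<epsilon>) t) (at t)" for t
    unfolding \<phi>_def using DERIV_diff[OF DH[of x t] DH[of "y - \<epsilon>" t]] by simp
  have \<phi>: "\<phi> t = H ((t - x) / \<epsilon>) - H ((t - (y - \<epsilon>)) / \<epsilon>)" for t
  proof -
    have "(1 / \<epsilon>) * t + (- z / \<epsilon>) = (t - z) / \<epsilon>" for z by (simp add: diff_divide_distrib)
    then show ?thesis unfolding \<phi>_def by metis
  qed
  have \<phi>0: "\<phi> t = 0" if "t \<notin> {x<..y}" for t
  proof (cases "t \<le> x")
    case True
    then have "(t - x) / \<epsilon> \<le> 0" "(t - (y - \<epsilon>)) / \<epsilon> \<le> 0"
      using \<epsilon> by (auto intro!: divide_nonpos_pos)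
    then show ?thesis by (simp add: \<phi> H0)
  next
    case False
    then have "1 \<le> (t - x) / \<epsilon>" "1 \<le> (t - (y - \<epsilon>)) / \<epsilon>"
      using that \<epsilon> by (auto simp: le_divide_eq_1)
    then show ?thesis by (simp add: \<phi> H1)
  qed
  have \<phi>1: "\<bar>\<phi> t\<bar> \<le> 1" for t
    using H01[of "(t - x) / \<epsilon>"] H01[of "(t - (y - \<epsilon>)) / \<epsilon>"]
    unfolding \<phi> by linarith
  have "test_function \<phi>"
  proof (rule test_function_primitive)
    show "(\<lambda>t. w x t + (-1) * w (y - \<epsilon>) t) \<in> bumps"
      by (intro bumps.add bumps_scale wb)
    show "\<phi> t = 0" if "t \<notin> {x..y}" for t using that \<phi>0 by auto
  qed (rule D\<phi>)
  then have eq: "(LINT t|lborel. deriv \<phi> t *\<^sub>R u t) = - (LINT t|lborel. \<phi> t *\<^sub>R g t)"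
    using weak by (simp add: is_weak_deriv_def)
  let ?I = "\<lambda>z. LINT t|lborel. w z t *\<^sub>R u t"
  have near_x: "cmod (u t - u x) \<le> \<eta>" if "t \<in> {x..x + \<epsilon>}" for t
    using d(3)[of t] that \<epsilon> by (auto simp: dist_norm)
  have near_y: "cmod (u t - u y) \<le> \<eta>" if "t \<in> {y - \<epsilon>..y - \<epsilon> + \<epsilon>}" for t
    using d(4)[of t] that \<epsilon> by (auto simp: dist_norm)
  note kx = kernel_average[OF u wint w0 wsupp near_x]
  note ky = kernel_average[OF u wint w0 wsupp near_y]
  have "(LINT t|lborel. deriv \<phi> t *\<^sub>R u t) = (LINT t|lborel. w x t *\<^sub>R u t - w (y - \<epsilon>) t *\<^sub>R u t)"
    by (simp add: DERIV_imp_deriv[OF D\<phi>] algebra_simps)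
  also have "\<dots> = ?I x - ?I (y - \<epsilon>)"
    by (rule Bochner_Integration.integral_diff[OF kx(1) ky(1)])
  finally have "?I (y - \<epsilon>) - ?I x = (LINT t|lborel. \<phi> t *\<^sub>R g t)"
    using eq by (metis minus_diff_eq minus_minus)
  moreover have "cmod (LINT t|lborel. \<phi> t *\<^sub>R g t) \<le> (LINT t:{x<..y}|lborel. cmod (g t))"
    unfolding set_lebesgue_integral_def
  proof (rule order_trans[OF integral_norm_bound integral_mono])
    have "continuous_on UNIV \<phi>"
      using DERIV_isCont[OF D\<phi>] by (simp add: continuous_at_imp_continuous_on)
    then have [measurable]: "\<phi> \<in> borel_measurable borel" by (rule borel_measurable_continuous_onI)
    have [measurable]: "g \<in> borel_measurable borel" using g by simp
    show le: "norm (\<phi> t *\<^sub>R g t) \<le> indicator {x<..y} t *\<^sub>R cmod (g t)" for t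
    proof (cases "t \<in> {x<..y}")
      case True
      then show ?thesis using mult_right_mono[OF \<phi>1[of t], of "cmod (g t)"] by simp
    qed (simp add: \<phi>0)
    show int: "integrable lborel (\<lambda>t. indicator {x<..y} t *\<^sub>R cmod (g t))"
      using g1 by (simp add: set_integrable_def)
    show "integrable lborel (\<lambda>t. norm (\<phi> t *\<^sub>R g t))"
    proof (rule Bochner_Integration.integrable_bound[OF int])
      show "(\<lambda>t. norm (\<phi> t *\<^sub>R g t)) \<in> borel_measurable lborel" by simp
      show "AE t in lborel. norm (norm (\<phi> t *\<^sub>R g t)) \<le> norm (indicator {x<..y} t *\<^sub>R cmod (g t))"
      proof (rule AE_I2)
        fix t
        show "norm (norm (\<phi> t *\<^sub>R g t)) \<le> norm (indicator {x<..y} t *\<^sub>R cmod (g t))"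
          by (subst real_norm_def, subst abs_norm_cancel) (rule order_trans[OF le], simp only: real_norm_def abs_ge_self)
      qed
    qed
  qed
  ultimately have mid: "cmod (?I (y - \<epsilon>) - ?I x) \<le> (LINT t:{x<..y}|lborel. cmod (g t))" by simp
  define P where "P = ?I (y - \<epsilon>) - ?I x"
  define Q where "Q = ?I x - u x"
  define R where "R = ?I (y - \<epsilon>) - u y"
  have "u y - u x = P + Q - R" by (simp add: P_def Q_def R_def)
  then have "cmod (u y - u x) \<le> cmod P + cmod Q + cmod R"
    using norm_triangle_ineq4[of "P + Q" R] norm_triangle_ineq[of P Q] by simp
  moreover have "cmod Q \<le> \<eta>" unfolding Q_def by (rule kx(2))
  moreover have "cmod R \<le> \<eta>" unfolding R_def by (rule ky(2))
  moreover have "cmod P \<le> (LINT t:{x<..y}|lborel. cmod (g t))" unfolding P_def by (rule mid)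
  ultimately show "cmod (u y - u x) \<le> (LINT t:{x<..y}|lborel. cmod (g t)) + e"
    by (simp add: \<eta>_def)
qed

text \<open>All later estimates use \<open>u\<close> only through this relation to a function \<open>G\<close>, in the role of
  \<open>\<integral>\<^bsub>(-\<infinity>,t]\<^esub> |u'|\<^sup>2\<close>.  The form makes additivity over adjacent intervals automatic and
  is stable under reflection.\<close>

definition energy_bound :: "(real \<Rightarrow> complex) \<Rightarrow> (real \<Rightarrow> real) \<Rightarrow> bool" where
  "energy_bound u G \<longleftrightarrow> (\<forall>x y. x \<le> y \<longrightarrow> (cmod (u y - u x))\<^sup>2 \<le> (y - x) * (G y - G x))"

lemma set_integral_Cauchy_Schwarz:
  fixes f :: "real \<Rightarrow> real"
  assumes "x < y" and f1: "set_integrable lborel {x<..y} f"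
    and f2: "set_integrable lborel {x<..y} (\<lambda>t. (f t)\<^sup>2)"
  shows "(LINT t:{x<..y}|lborel. f t)\<^sup>2 \<le> (y - x) * (LINT t:{x<..y}|lborel. (f t)\<^sup>2)"
proof -
  define J where "J = (LINT t:{x<..y}|lborel. f t)"
  define E where "E = (LINT t:{x<..y}|lborel. (f t)\<^sup>2)"
  \<comment> \<open>the mean of \<open>f\<close>; the claim is that the variance is nonnegative\<close>
  define m where "m = J / (y - x)"
  have c: "set_integrable lborel {x<..y} (\<lambda>_. m\<^sup>2)"
    using assms(1) by (simp add: set_integrable_def integrable_indicator_iff)
  have eq: "(f t - m)\<^sup>2 = ((f t)\<^sup>2 - (2 * m) * f t) + m\<^sup>2" for t
    by (simp add: power2_eq_square algebra_simps)
  have "0 \<le> (LINT t:{x<..y}|lborel. (f t - m)\<^sup>2)"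
    unfolding set_lebesgue_integral_def by (rule integral_nonneg_AE) (simp add: indicator_def)
  also have "\<dots> = (E - 2 * m * J) + (LINT t:{x<..y}|lborel. m\<^sup>2)"
    unfolding eq E_def J_def
    by (subst set_integral_add(2) set_integral_diff(2) set_integral_mult_right
        | intro set_integral_diff(1) set_integrable_mult_right impI c f1 f2 refl)+
  also have "(LINT t:{x<..y}|lborel. m\<^sup>2) = m\<^sup>2 * (y - x)"
    using assms(1) by (subst set_integral_const) auto
  finally have "0 \<le> E - J\<^sup>2 / (y - x)"
    using assms(1) by (simp add: m_def power2_eq_square)
  then show ?thesis
    using assms(1) unfolding J_def E_def by (simp add: field_simps)
qed

lemma W12_energy:
  assumes "u \<in> W12"
  defines "G \<equiv> \<lambda>t. LINT s:{..t}|lborel. (cmod (weak_deriv u s))\<^sup>2"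
  shows "energy_bound u G"
    and "G y - G x \<le> (LINT s|lborel. (cmod (weak_deriv u s))\<^sup>2)"
proof -
  define g where "g = weak_deriv u"
  have u: "continuous_on UNIV u" and ex: "\<exists>g. g \<in> L2 lborel \<and> is_weak_deriv u g"
    using assms(1) by (auto simp: W12_def)
  have g: "g \<in> L2 lborel" and weak: "is_weak_deriv u g"
    using someI_ex[OF ex] by (auto simp: g_def weak_deriv_def)
  have gm: "g \<in> borel_measurable lborel" and g2: "integrable lborel (\<lambda>s. (cmod (g s))\<^sup>2)"
    using g by (auto simp: L2_def)
  have [measurable]: "g \<in> borel_measurable borel" using gm by simp
  have si: "set_integrable lborel A (\<lambda>s. (cmod (g s))\<^sup>2)" if "A \<in> sets borel" for A
    using g2 that unfolding set_integrable_def by (intro integrable_mult_indicator) auto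
  have Gdiff: "G y - G x = (LINT s:{x<..y}|lborel. (cmod (g s))\<^sup>2)" if "x \<le> y" for x y
  proof -
    have "{..y} = {..x} \<union> {x<..y}" using that by auto
    then have "G y = G x + (LINT s:{x<..y}|lborel. (cmod (g s))\<^sup>2)"
      unfolding G_def g_def[symmetric] by (simp only:) (intro set_integral_Un si, auto)
    then show ?thesis by simp
  qed
  show "energy_bound u G"
    unfolding energy_bound_def
  proof (intro allI impI)
    fix x y :: real assume "x \<le> y"
    show "(cmod (u y - u x))\<^sup>2 \<le> (y - x) * (G y - G x)"
    proof (cases "x = y")
      case False
      then have xy: "x < y" using \<open>x \<le> y\<close> by simp
      have i1: "set_integrable lborel {x<..y} (\<lambda>t. cmod (g t))"
      proof (rule set_integrable_bound)
        show "set_integrable lborel {x<..y} (\<lambda>t. 1 + (cmod (g t))\<^sup>2)"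
          by (intro set_integral_add(1) si) (use xy in \<open>simp_all add: set_integrable_def integrable_indicator_iff\<close>)
        show "set_borel_measurable lborel {x<..y} (\<lambda>t. cmod (g t))"
          unfolding set_borel_measurable_def by simp
        have "cmod z \<le> \<bar>1 + (cmod z)\<^sup>2\<bar>" for z
          using zero_le_power2[of "cmod z - 1 / 2"] by (simp add: power2_eq_square algebra_simps) 
        then show "AE t in lborel. t \<in> {x<..y} \<longrightarrow> norm (cmod (g t)) \<le> norm (1 + (cmod (g t))\<^sup>2)"
          by simp
      qed
      have "(cmod (u y - u x))\<^sup>2 \<le> (LINT t:{x<..y}|lborel. cmod (g t))\<^sup>2"
        using weak_deriv_increment[OF u gm i1 weak xy] by (intro power_mono) auto
      also have "\<dots> \<le> (y - x) * (LINT s:{x<..y}|lborel. (cmod (g s))\<^sup>2)"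
        by (rule set_integral_Cauchy_Schwarz[OF xy i1 si]) simp
      finally show ?thesis by (simp add: Gdiff[OF \<open>x \<le> y\<close>])
    qed simp
  qed
  have le: "(LINT s:A|lborel. (cmod (g s))\<^sup>2) \<le> (LINT s|lborel. (cmod (g s))\<^sup>2)" if "A \<in> sets borel" for A
    unfolding set_lebesgue_integral_def
    by (rule integral_mono) (use si[OF that] g2 in \<open>auto simp: set_integrable_def indicator_def\<close>)
  show "G y - G x \<le> (LINT s|lborel. (cmod (weak_deriv u s))\<^sup>2)"
  proof -
    have "G x \<ge> 0" unfolding G_def set_lebesgue_integral_def
      by (rule integral_nonneg_AE) (simp add: indicator_def)
    moreover have "G y \<le> (LINT s|lborel. (cmod (weak_deriv u s))\<^sup>2)"
      unfolding G_def g_def[symmetric] by (rule le) simp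
    ultimately show ?thesis by simp
  qed
qed

section \<open>Estimates on one interval\<close>

lemma energy_boundD:
  "energy_bound u G \<Longrightarrow> x \<le> y \<Longrightarrow> (cmod (u y - u x))\<^sup>2 \<le> (y - x) * (G y - G x)"
  by (simp add: energy_bound_def)

lemma energy_bound_mono:
  assumes "energy_bound u G" "x \<le> y" shows "G x \<le> G y"
proof (cases "x = y")
  case False
  then show ?thesis
    using energy_boundD[OF assms] assms(2) zero_le_power2[of "cmod (u y - u x)"]
    by (smt (verit) mult_pos_neg)
qed simp

text \<open>The right-hand sides are the minima of the left-hand sides over \<open>\<alpha>\<close>; in the second part
  \<open>q > p\<close> makes the coefficient of \<open>\<alpha>\<^sup>2\<close> positive.\<close>

lemma quadratic_form_sum_lower:
  fixes \<xi> \<alpha> p q :: real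
  assumes "p > 0" "q > 0"
  shows "(\<xi> - \<alpha>)\<^sup>2 / p + \<alpha>\<^sup>2 / q \<ge> \<xi>\<^sup>2 / (p + q)"
    and "q > p \<Longrightarrow> (\<xi> - \<alpha>)\<^sup>2 / p - \<alpha>\<^sup>2 / q \<ge> - \<xi>\<^sup>2 / (q - p)"
proof -
  have "(\<xi> - \<alpha>)\<^sup>2 / p + \<alpha>\<^sup>2 / q - \<xi>\<^sup>2 / (p + q) = (q * \<xi> - (p + q) * \<alpha>)\<^sup>2 / (p * q * (p + q))"
    using assms by (simp add: divide_simps) (simp add: power2_eq_square algebra_simps)
  then show "(\<xi> - \<alpha>)\<^sup>2 / p + \<alpha>\<^sup>2 / q \<ge> \<xi>\<^sup>2 / (p + q)"
    using assms by (smt (verit) divide_nonneg_pos mult_pos_pos zero_le_power2)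
next
  assume qp: "q > p"
  have "(\<xi> - \<alpha>)\<^sup>2 / p - \<alpha>\<^sup>2 / q + \<xi>\<^sup>2 / (q - p) = (q * \<xi> - (q - p) * \<alpha>)\<^sup>2 / (p * q * (q - p))"
    using assms qp by (simp add: divide_simps) (simp add: power2_eq_square algebra_simps)
  moreover have "\<dots> \<ge> 0"
    using assms qp by (intro divide_nonneg_pos mult_pos_pos) auto
  ultimately show "(\<xi> - \<alpha>)\<^sup>2 / p - \<alpha>\<^sup>2 / q \<ge> - \<xi>\<^sup>2 / (q - p)" by simp
qed

lemma sqrt_mult_superadditive:
  fixes p q r s :: real
  assumes "0 \<le> p" "0 \<le> q" "0 \<le> r" "0 \<le> s"
  shows "sqrt (p * q) + sqrt (r * s) \<le> sqrt ((p + r) * (q + s))"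
proof (rule real_le_rsqrt)
  have "2 * (sqrt (p * q) * sqrt (r * s)) = 2 * (sqrt (p * s) * sqrt (r * q))"
    by (simp add: real_sqrt_mult algebra_simps)
  also have "\<dots> \<le> p * s + r * q"
    using zero_le_power2[of "sqrt (p * s) - sqrt (r * q)"] assms by (simp add: power2_diff)
  finally show "(sqrt (p * q) + sqrt (r * s))\<^sup>2 \<le> (p + r) * (q + s)"
    using assms by (simp add: power2_sum algebra_simps)
qed

lemma norm_diff_square_le: "(cmod z - cmod w)\<^sup>2 \<le> (cmod (z - w))\<^sup>2"
  by (metis abs_le_square_iff abs_norm_cancel norm_triangle_ineq3)

text \<open>With \<open>\<xi> = |u x|\<close> fixed, the right-hand side is smallest for the boundary values that minimise the
  two one-sided quadratic forms, which leaves \<open>\<xi>\<^sup>2 (1 / (x + a) - 1 / (x + 2 a))\<close>.  This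
  dominates \<open>\<xi>\<^sup>2 / (6 x)\<close> exactly because \<open>(x - a) (2 a - x) \<ge> 0\<close>, with equality at both ends of
  the octave.\<close>

lemma octave_pointwise:
  assumes G: "energy_bound u G" and a: "0 < a" and x: "x \<in> {a..2 * a}"
  shows "(cmod (u x))\<^sup>2 / (6 * x)
    \<le> G (2 * a) - G a + (cmod (u a))\<^sup>2 / (2 * a) - (cmod (u (2 * a)))\<^sup>2 / (4 * a)"
proof -
  define \<alpha> \<xi> \<beta> where "\<alpha> = cmod (u a)" and "\<xi> = cmod (u x)" and "\<beta> = cmod (u (2 * a))"
  have pos: "x > 0" using a x by auto
  have left: "\<xi>\<^sup>2 / (x + a) \<le> G x - G a + \<alpha>\<^sup>2 / (2 * a)"
  proof (cases "x = a")
    case True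
    then show ?thesis by (simp add: \<xi>_def \<alpha>_def)
  next
    case False
    then have xa: "x - a > 0" using x by auto
    have "(\<xi> - \<alpha>)\<^sup>2 \<le> (cmod (u x - u a))\<^sup>2"
      unfolding \<xi>_def \<alpha>_def by (rule norm_diff_square_le)
    also have "\<dots> \<le> (x - a) * (G x - G a)" using energy_boundD[OF G] xa by simp
    finally have "(\<xi> - \<alpha>)\<^sup>2 / (x - a) \<le> G x - G a" using xa by (simp add: divide_le_eq mult.commute)
    moreover have "\<xi>\<^sup>2 / ((x - a) + 2 * a) \<le> (\<xi> - \<alpha>)\<^sup>2 / (x - a) + \<alpha>\<^sup>2 / (2 * a)"
      using xa a by (intro quadratic_form_sum_lower(1)) auto
    ultimately show ?thesis by (simp add: add.commute[of x])
  qed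
  have right: "- \<xi>\<^sup>2 / (x + 2 * a) \<le> G (2 * a) - G x - \<beta>\<^sup>2 / (4 * a)"
  proof (cases "x = 2 * a")
    case True
    then show ?thesis by (simp add: \<xi>_def \<beta>_def)
  next
    case False
    then have xa: "2 * a - x > 0" using x by auto
    have "(\<xi> - \<beta>)\<^sup>2 \<le> (cmod (u (2 * a) - u x))\<^sup>2"
      unfolding \<xi>_def \<beta>_def norm_minus_commute[of "u (2 * a)"] by (rule norm_diff_square_le)
    also have "\<dots> \<le> (2 * a - x) * (G (2 * a) - G x)" using energy_boundD[OF G] xa by simp
    finally have "(\<xi> - \<beta>)\<^sup>2 / (2 * a - x) \<le> G (2 * a) - G x"
      using xa by (simp add: divide_le_eq mult.commute)
    moreover have "- \<xi>\<^sup>2 / (4 * a - (2 * a - x)) \<le> (\<xi> - \<beta>)\<^sup>2 / (2 * a - x) - \<beta>\<^sup>2 / (4 * a)"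
      using xa a pos by (intro quadratic_form_sum_lower(2)) auto
    ultimately show ?thesis by (simp add: add.commute[of x])
  qed
  have "x\<^sup>2 + 2 * a\<^sup>2 \<le> 3 * a * x"
    using mult_nonneg_nonneg[of "x - a" "2 * a - x"] x by (simp add: power2_eq_square algebra_simps)
  then have "(x + a) * (x + 2 * a) \<le> 6 * a * x" by (simp add: power2_eq_square algebra_simps)
  then have "a / ((x + a) * (x + 2 * a)) \<ge> a / (6 * a * x)"
    using a pos by (intro divide_left_mono) auto
  then have "1 / (6 * x) \<le> a / ((x + a) * (x + 2 * a))" using a pos by simp
  also have "\<dots> = 1 / (x + a) - 1 / (x + 2 * a)"
    using a pos by (simp add: field_simps)
  finally have "\<xi>\<^sup>2 * (1 / (6 * x)) \<le> \<xi>\<^sup>2 * (1 / (x + a) - 1 / (x + 2 * a))"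
    by (rule mult_left_mono) simp
  then show ?thesis using left right
    unfolding \<xi>_def[symmetric] \<alpha>_def[symmetric] \<beta>_def[symmetric] by (simp add: algebra_simps)
qed

locale locally_finite_measure =
  fixes \<mu> :: "real measure"
  assumes sets_borel: "sets \<mu> = sets borel"
    and finite_compact: "compact K \<Longrightarrow> emeasure \<mu> K < \<infinity>"
begin

lemma emeasure_bounded:
  assumes "S \<in> sets borel" "bounded S" shows "emeasure \<mu> S < \<infinity>"
proof -
  have "emeasure \<mu> S \<le> emeasure \<mu> (closure S)"
    by (rule emeasure_mono) (auto simp: sets_borel closure_subset)
  also have "\<dots> < \<infinity>" using assms by (intro finite_compact) (simp add: compact_closure)
  finally show ?thesis .
qed

lemma set_integrable_continuous:
  fixes f :: "real \<Rightarrow> real"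
  assumes S: "S \<in> sets borel" "bounded S" and f: "continuous_on UNIV f"
  shows "set_integrable \<mu> S f"
proof -
  have "compact (f ` closure S)"
    using S f by (intro compact_continuous_image) (auto simp: compact_closure intro: continuous_on_subset)
  then obtain B where B: "\<And>x. x \<in> S \<Longrightarrow> norm (f x) \<le> B"
    using closure_subset[of S] unfolding compact_eq_bounded_closed bounded_iff by blast
  have "f \<in> borel_measurable \<mu>"
    using borel_measurable_continuous_onI[OF f] measurable_cong_sets[OF sets_borel refl] by blast
  then show ?thesis
    unfolding set_integrable_def using S emeasure_bounded[OF S] B
    by (intro integrableI_bounded_set_indicator[where B = B]) (auto simp: sets_borel)
qed

lemma set_integral_le_measure:
  fixes f :: "real \<Rightarrow> real"
  assumes S: "S \<in> sets borel" "bounded S" and f: "continuous_on UNIV f"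
    and le: "\<And>x. x \<in> S \<Longrightarrow> f x \<le> c"
  shows "(LINT x:S|\<mu>. f x) \<le> c * measure \<mu> S"
proof -
  have "(LINT x:S|\<mu>. f x) \<le> (LINT x:S|\<mu>. c)"
    by (rule set_integral_mono) (use S f le in \<open>auto intro!: set_integrable_continuous\<close>)
  also have "\<dots> = c * measure \<mu> S"
    using emeasure_bounded[OF S] S by (subst set_integral_const) (auto simp: sets_borel)
  finally show ?thesis .
qed

lemma set_integral_split:
  fixes f :: "real \<Rightarrow> real"
  assumes "continuous_on UNIV f" "a \<le> b" "b \<le> c"
  shows "(LINT x:{a<..c}|\<mu>. f x) = (LINT x:{a<..b}|\<mu>. f x) + (LINT x:{b<..c}|\<mu>. f x)"
proof -
  have "{a<..c} = {a<..b} \<union> {b<..c}" using assms by auto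
  then show ?thesis
    by (simp only:) (rule set_integral_Un, use assms in \<open>auto intro!: set_integrable_continuous\<close>)
qed

lemma measure_split:
  assumes "a \<le> b" "b \<le> c"
  shows "measure \<mu> {a<..c} = measure \<mu> {a<..b} + measure \<mu> {b<..c}"
proof -
  have "{a<..c} = {a<..b} \<union> {b<..c}" using assms by auto
  moreover have "emeasure \<mu> {a<..b} \<noteq> \<infinity>" "emeasure \<mu> {b<..c} \<noteq> \<infinity>"
    using emeasure_bounded[of "{a<..b}"] emeasure_bounded[of "{b<..c}"] by auto
  ultimately show ?thesis
    by (simp only:) (rule measure_Union, auto simp: sets_borel)
qed

text \<open>The open interval suffices in the smallness condition because \<open>u\<close> vanishes at \<open>t\<close>;
  an atom at a chosen point is therefore harmless, whatever its size.\<close>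

lemma piece_two_zeros:
  assumes u: "continuous_on UNIV u" and G: "energy_bound u G" and at: "a \<le> t"
    and zero: "u a = 0" "u t = 0" and small: "(t - a) * measure \<mu> {a<..<t} \<le> 1"
  shows "(LINT x:{a<..t}|\<mu>. (cmod (u x))\<^sup>2) \<le> G t - G a"
proof -
  have c: "continuous_on UNIV (\<lambda>x. (cmod (u x))\<^sup>2)" using u by (intro continuous_intros)
  have "(LINT x:{a<..t}|\<mu>. (cmod (u x))\<^sup>2) = (LINT x:{a<..<t}|\<mu>. (cmod (u x))\<^sup>2)"
    unfolding set_lebesgue_integral_def
    by (rule Bochner_Integration.integral_cong) (use zero in \<open>auto simp: indicator_def\<close>)
  also have "\<dots> \<le> ((t - a) * (G t - G a)) * measure \<mu> {a<..<t}"
  proof (rule set_integral_le_measure[OF _ _ c])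
    fix x assume x: "x \<in> {a<..<t}"
    have "(cmod (u x))\<^sup>2 \<le> (x - a) * (G x - G a)" using energy_boundD[OF G, of a x] x zero by simp
    also have "\<dots> \<le> (t - a) * (G t - G a)"
      using x energy_bound_mono[OF G, of x t] energy_bound_mono[OF G, of a x] by (intro mult_mono) auto
    finally show "(cmod (u x))\<^sup>2 \<le> (t - a) * (G t - G a)" .
  qed auto
  also have "\<dots> = ((t - a) * measure \<mu> {a<..<t}) * (G t - G a)" by simp
  also have "\<dots> \<le> 1 * (G t - G a)"
    using small energy_bound_mono[OF G at] by (intro mult_right_mono) auto
  finally show ?thesis by simp
qed

text \<open>One half of the energy pays for the integral and the other half for the boundary term.\<close>

lemma piece_one_zero:
  assumes u: "continuous_on UNIV u" and G: "energy_bound u G" and ab: "0 \<le> a" "a \<le> b" "0 < b"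
    and zero: "u a = 0" and small: "(b - a) * measure \<mu> {a<..b} \<le> 1 / 2"
  shows "(LINT x:{a<..b}|\<mu>. (cmod (u x))\<^sup>2) + (cmod (u b))\<^sup>2 / (2 * b) \<le> G b - G a"
proof -
  have c: "continuous_on UNIV (\<lambda>x. (cmod (u x))\<^sup>2)" using u by (intro continuous_intros)
  note mono = energy_bound_mono[OF G]
  have "(LINT x:{a<..b}|\<mu>. (cmod (u x))\<^sup>2) \<le> ((b - a) * (G b - G a)) * measure \<mu> {a<..b}"
  proof (rule set_integral_le_measure[OF _ _ c])
    fix x assume x: "x \<in> {a<..b}"
    have "(cmod (u x))\<^sup>2 \<le> (x - a) * (G x - G a)" using energy_boundD[OF G, of a x] x zero by simp
    also have "\<dots> \<le> (b - a) * (G b - G a)"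
      using x mono[of x b] mono[of a x] by (intro mult_mono) auto
    finally show "(cmod (u x))\<^sup>2 \<le> (b - a) * (G b - G a)" .
  qed auto
  also have "\<dots> = ((b - a) * measure \<mu> {a<..b}) * (G b - G a)" by simp
  also have "\<dots> \<le> 1 / 2 * (G b - G a)"
    using small mono[OF ab(2)] by (intro mult_right_mono) auto
  finally have 1: "(LINT x:{a<..b}|\<mu>. (cmod (u x))\<^sup>2) \<le> 1 / 2 * (G b - G a)" .
  have "(cmod (u b))\<^sup>2 \<le> (b - a) * (G b - G a)" using energy_boundD[OF G ab(2)] zero by simp
  also have "\<dots> \<le> b * (G b - G a)" using ab mono[OF ab(2)] by (intro mult_right_mono) auto
  finally have "(cmod (u b))\<^sup>2 / (2 * b) \<le> 1 / 2 * (G b - G a)"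
    using ab by (simp add: divide_le_eq mult.commute)
  then show ?thesis using 1 by simp
qed

text \<open>The octave step without zeros, obtained by integrating \<open>octave_pointwise\<close> against the
  measure.\<close>

lemma octave_small:
  assumes u: "continuous_on UNIV u" and G: "energy_bound u G" and a: "0 < a"
    and small: "(LINT x:{a..2 * a}|\<mu>. \<bar>x\<bar>) \<le> 1 / 6"
  shows "(LINT x:{a<..2 * a}|\<mu>. (cmod (u x))\<^sup>2) + (cmod (u (2 * a)))\<^sup>2 / (4 * a)
    \<le> G (2 * a) - G a + (cmod (u a))\<^sup>2 / (2 * a)"
proof -
  define Q where "Q = G (2 * a) - G a + (cmod (u a))\<^sup>2 / (2 * a) - (cmod (u (2 * a)))\<^sup>2 / (4 * a)"
  have pw: "(cmod (u x))\<^sup>2 \<le> 6 * Q * \<bar>x\<bar>" if "x \<in> {a..2 * a}" for x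
    using octave_pointwise[OF G a that] that a unfolding Q_def[symmetric]
    by (simp add: divide_le_eq algebra_simps)
  have "0 \<le> (cmod (u a))\<^sup>2 / (6 * a)" using a by simp
  also have "\<dots> \<le> Q" unfolding Q_def using octave_pointwise[OF G a, of a] a by simp
  finally have Q: "0 \<le> Q" .
  have c: "continuous_on UNIV (\<lambda>x. (cmod (u x))\<^sup>2)" using u by (intro continuous_intros)
  have c1: "continuous_on UNIV (\<lambda>x::real. 6 * Q * \<bar>x\<bar>)" by (intro continuous_intros)
  have "(LINT x:{a<..2 * a}|\<mu>. (cmod (u x))\<^sup>2) \<le> (LINT x:{a<..2 * a}|\<mu>. 6 * Q * \<bar>x\<bar>)"
    by (rule set_integral_mono) (use pw in \<open>auto intro!: set_integrable_continuous c c1\<close>)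
  also have "\<dots> \<le> (LINT x:{a..2 * a}|\<mu>. 6 * Q * \<bar>x\<bar>)"
    using set_integrable_continuous[OF _ _ c1, of "{a<..2 * a}"]
      set_integrable_continuous[OF _ _ c1, of "{a..2 * a}"] Q
    unfolding set_lebesgue_integral_def set_integrable_def
    by (intro integral_mono) (auto simp: indicator_def)
  also have "\<dots> = 6 * Q * (LINT x:{a..2 * a}|\<mu>. \<bar>x\<bar>)" by (simp add: mult.assoc)
  also have "\<dots> \<le> 6 * Q * (1 / 6)" using small Q by (intro mult_left_mono) auto
  finally show ?thesis by (simp add: Q_def)
qed

section \<open>Greedy choice of zeros\<close>

text \<open>With \<open>f t = (t - a) \<mu> (a, t]\<close>, the point sought is the infimum of \<open>{t. c \<le> f t}\<close>.  An atom may
  make \<open>f\<close> jump over \<open>c\<close>; right continuity of \<open>f\<close> gives the lower bound, and the left limit of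
  \<open>f\<close>, which involves the open interval, gives the upper one.\<close>

lemma critical_point:
  assumes ab: "a < b" and c: "0 < c" "c \<le> (b - a) * measure \<mu> {a<..b}"
  obtains t where "a < t" "t \<le> b" "(t - a) * measure \<mu> {a<..<t} \<le> c" "c \<le> (t - a) * measure \<mu> {a<..t}"
proof -
  define f where "f s = (s - a) * measure \<mu> {a<..s}" for s
  have fin: "emeasure \<mu> {a<..s} \<noteq> \<infinity>" "emeasure \<mu> {a<..<s} \<noteq> \<infinity>" for s
    using emeasure_bounded[of "{a<..s}"] emeasure_bounded[of "{a<..<s}"] by auto
  have mono: "f r \<le> f s" if "a \<le> r" "r \<le> s" for r s
    unfolding f_def using that fin
    by (intro mult_mono measure_mono_fmeasurable) (auto simp: fmeasurable_def sets_borel less_top)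
  define S where "S = {s\<in>{a..b}. c \<le> f s}"
  define t where "t = Inf S"
  have bS: "b \<in> S" using ab c by (auto simp: S_def f_def)
  have bdd: "bdd_below S" by (rule bdd_belowI[of _ a]) (auto simp: S_def)
  have tb: "t \<le> b" unfolding t_def using bS bdd by (rule cInf_lower)
  have at: "a \<le> t" unfolding t_def using bS by (intro cInf_greatest) (auto simp: S_def)
  have above: "c \<le> f s" if "t < s" for s
  proof -
    have "S \<noteq> {}" using bS by auto
    then have "\<exists>r\<in>S. r < s" using that cInf_less_iff[of S s] bdd unfolding t_def by simp
    then obtain r where r: "r \<in> S" "r < s" by blast
    then have "a \<le> r" "c \<le> f r" by (auto simp: S_def)
    then show ?thesis using mono[of r s] r(2) by simp
  qed
  have below: "f s < c" if "a \<le> s" "s < t" for s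
  proof -
    have "s \<notin> S" using cInf_lower[OF _ bdd, of s] that(2) unfolding t_def by auto
    then show ?thesis using that tb by (auto simp: S_def)
  qed
  have ct: "c \<le> f t"
  proof (rule LIMSEQ_le_const)
    define s where "s n = t + inverse (real (Suc n))" for n
    have lim: "s \<longlonglongrightarrow> t" unfolding s_def by (rule LIMSEQ_inverse_real_of_nat_add)
    have "(\<lambda>n. measure \<mu> {a<..s n}) \<longlonglongrightarrow> measure \<mu> (\<Inter>n. {a<..s n})"
    proof (rule Lim_measure_decseq)
      have anti: "s n \<le> s m" if "m \<le> n" for m n
        unfolding s_def using that by (intro add_left_mono le_imp_inverse_le) auto
      have "{a<..s n} \<subseteq> {a<..s m}" if "m \<le> n" for m n using anti[OF that] by auto
      then show "decseq (\<lambda>n. {a<..s n})" by (simp add: decseq_def)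
    qed (use fin in \<open>auto simp: sets_borel\<close>)
    also have "(\<Inter>n. {a<..s n}) = {a<..t}"
    proof (intro set_eqI iffI)
      fix x assume x: "x \<in> (\<Inter>n. {a<..s n})"
      then have "x \<le> t" by (intro LIMSEQ_le_const[OF lim]) auto
      then show "x \<in> {a<..t}" using x by auto
    next
      fix x assume "x \<in> {a<..t}"
      moreover have "t \<le> s n" for n by (simp add: s_def)
      ultimately show "x \<in> (\<Inter>n. {a<..s n})" by (auto intro: order_trans)
    qed
    finally show "(\<lambda>n. f (s n)) \<longlonglongrightarrow> f t"
      unfolding f_def by (intro tendsto_intros lim)
    show "\<exists>N. \<forall>n\<ge>N. c \<le> f (s n)" by (intro exI allI impI above) (simp add: s_def)
  qed
  have "a < t" using at ct c(1) by (cases "t = a") (auto simp: f_def)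
  have "(t - a) * measure \<mu> {a<..<t} \<le> c"
  proof (rule LIMSEQ_le_const2)
    define s where "s n = t - (t - a) * inverse (real (Suc n))" for n
    have "s \<longlonglongrightarrow> t - (t - a) * 0"
      unfolding s_def by (intro tendsto_intros LIMSEQ_inverse_real_of_nat)
    then have lim: "s \<longlonglongrightarrow> t" by simp
    have s: "a \<le> s n" "s n < t" for n
    proof -
      have "0 < inverse (real (Suc n))" "inverse (real (Suc n)) \<le> 1"
        by (auto simp: inverse_le_1_iff)
      then have "(t - a) * inverse (real (Suc n)) \<le> (t - a) * 1" "0 < (t - a) * inverse (real (Suc n))"
        using \<open>a < t\<close> by (auto intro: mult_left_mono simp del: of_nat_Suc)
      then show "a \<le> s n" "s n < t" unfolding s_def by simp_all
    qed
    have "(\<lambda>n. measure \<mu> {a<..s n}) \<longlonglongrightarrow> measure \<mu> (\<Union>n. {a<..s n})"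
    proof (rule Lim_measure_incseq)
      have mono_s: "s m \<le> s n" if "m \<le> n" for m n
        unfolding s_def using \<open>a < t\<close> that
        by (intro diff_left_mono mult_left_mono le_imp_inverse_le) auto
      have "{a<..s m} \<subseteq> {a<..s n}" if "m \<le> n" for m n using mono_s[OF that] by auto
      then show "incseq (\<lambda>n. {a<..s n})" by (simp add: incseq_def)
      have "emeasure \<mu> (\<Union>n. {a<..s n}) \<le> emeasure \<mu> {a<..t}"
      proof (intro emeasure_mono UN_least)
        show "{a<..s n} \<subseteq> {a<..t}" for n using s(2)[of n] by auto
      qed (simp add: sets_borel)
      then show "emeasure \<mu> (\<Union>n. {a<..s n}) \<noteq> \<infinity>" using fin(1)[of t] by (auto simp: top_unique)
    qed (auto simp: sets_borel)
    also have "(\<Union>n. {a<..s n}) = {a<..<t}"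
    proof (intro set_eqI iffI)
      fix x assume "x \<in> (\<Union>n. {a<..s n})"
      then show "x \<in> {a<..<t}" using s by (auto intro: order.strict_trans1)
    next
      fix x assume x: "x \<in> {a<..<t}"
      then have "\<forall>\<^sub>F n in sequentially. x < s n" by (intro order_tendstoD(1)[OF lim]) auto
      then obtain n where "x < s n" by (auto simp: eventually_sequentially)
      then show "x \<in> (\<Union>n. {a<..s n})" using x by (auto intro!: exI[of _ n])
    qed
    finally show "(\<lambda>n. f (s n)) \<longlonglongrightarrow> (t - a) * measure \<mu> {a<..<t}"
      unfolding f_def by (intro tendsto_intros lim)
    show "\<exists>N. \<forall>n\<ge>N. f (s n) \<le> c"
      using below[OF s] by (auto intro: less_imp_le)
  qed
  then show thesis using that[of t] \<open>a < t\<close> tb ct by (simp add: f_def)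
qed

text \<open>The points \<open>T\<close> do not depend on \<open>u\<close>, as they must give linear conditions on \<open>u\<close>.\<close>

definition controlled_by_zeros :: "real set \<Rightarrow> real \<Rightarrow> real \<Rightarrow> bool" where
  "controlled_by_zeros T a b \<longleftrightarrow> (\<forall>u G. continuous_on UNIV u \<longrightarrow> energy_bound u G \<longrightarrow> u a = 0 \<longrightarrow>
     (\<forall>t\<in>T. u t = 0) \<longrightarrow>
     (LINT x:{a<..b}|\<mu>. (cmod (u x))\<^sup>2) + (cmod (u b))\<^sup>2 / (2 * b) \<le> G b - G a)"

text \<open>Each point is placed where length times mass, measured from the previous point, passes
  \<open>1/2\<close>.  The part cut off has \<open>sqrt (2 * length * mass) \<ge> 1\<close>, hence by superadditivity the
  same quantity for the rest is smaller by at least \<open>1\<close> than for the whole, and the induction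
  on \<open>N\<close> applies to the rest.\<close>

lemma greedy_zeros:
  assumes "0 \<le> a" "a \<le> b" "0 < b" "sqrt (2 * ((b - a) * measure \<mu> {a<..b})) \<le> real N + 1"
  shows "\<exists>T. finite T \<and> card T \<le> N \<and> controlled_by_zeros T a b"
  using assms
proof (induction N arbitrary: a)
  case 0
  then have "sqrt (2 * ((b - a) * measure \<mu> {a<..b})) \<le> sqrt 1" by simp
  then have "(b - a) * measure \<mu> {a<..b} \<le> 1 / 2"
    unfolding real_sqrt_le_iff by simp
  then have "controlled_by_zeros {} a b"
    unfolding controlled_by_zeros_def using 0 by (auto intro!: piece_one_zero)
  then show ?case by (intro exI[of _ "{}"]) simp
next
  case (Suc N)
  show ?case
  proof (cases "(b - a) * measure \<mu> {a<..b} \<le> 1 / 2")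
    case True
    then have "controlled_by_zeros {} a b"
      unfolding controlled_by_zeros_def using Suc.prems by (auto intro!: piece_one_zero)
    then show ?thesis by (intro exI[of _ "{}"]) simp
  next
    case False
    then have "a < b" using Suc.prems(2) by (cases "a = b") auto
    obtain t where t: "a < t" "t \<le> b" "(t - a) * measure \<mu> {a<..<t} \<le> 1 / 2"
      "1 / 2 \<le> (t - a) * measure \<mu> {a<..t}"
      using critical_point[OF \<open>a < b\<close>, of "1 / 2"] False by auto
    have "1 = sqrt (2 * (1 / 2))" by simp
    also have "\<dots> \<le> sqrt (2 * ((t - a) * measure \<mu> {a<..t}))"
      using t(4) by (intro real_sqrt_le_mono mult_left_mono) auto
    finally have "1 + sqrt (2 * ((b - t) * measure \<mu> {t<..b}))
        \<le> sqrt ((2 * (t - a)) * measure \<mu> {a<..t}) + sqrt ((2 * (b - t)) * measure \<mu> {t<..b})"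
      by (simp only: mult.assoc add_right_mono)
    also have "\<dots> \<le> sqrt ((2 * (t - a) + 2 * (b - t)) * (measure \<mu> {a<..t} + measure \<mu> {t<..b}))"
      using t by (intro sqrt_mult_superadditive) auto
    also have "\<dots> = sqrt (2 * ((b - a) * measure \<mu> {a<..b}))"
      using t measure_split[of a t b] by (simp add: algebra_simps)
    also have "\<dots> \<le> real (Suc N) + 1" by (rule Suc.prems(4))
    finally have "sqrt (2 * ((b - t) * measure \<mu> {t<..b})) \<le> real N + 1" by simp
    with Suc.IH[of t] obtain T where T: "finite T" "card T \<le> N" "controlled_by_zeros T t b"
      using t Suc.prems by auto
    have "controlled_by_zeros (insert t T) a b"
      unfolding controlled_by_zeros_def
    proof (intro allI impI)
      fix u G assume u: "continuous_on UNIV u" and G: "energy_bound u G" and "u a = 0"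
        and zero: "\<forall>s\<in>insert t T. u s = 0"
      have "(LINT x:{a<..t}|\<mu>. (cmod (u x))\<^sup>2) \<le> G t - G a"
        using t zero \<open>u a = 0\<close> by (intro piece_two_zeros[OF u G]) auto
      moreover have "(LINT x:{t<..b}|\<mu>. (cmod (u x))\<^sup>2) + (cmod (u b))\<^sup>2 / (2 * b) \<le> G b - G t"
        using T(3) u G zero unfolding controlled_by_zeros_def by auto
      moreover have "(LINT x:{a<..b}|\<mu>. (cmod (u x))\<^sup>2)
          = (LINT x:{a<..t}|\<mu>. (cmod (u x))\<^sup>2) + (LINT x:{t<..b}|\<mu>. (cmod (u x))\<^sup>2)"
        using t u by (intro set_integral_split continuous_intros) auto
      ultimately show "(LINT x:{a<..b}|\<mu>. (cmod (u x))\<^sup>2) + (cmod (u b))\<^sup>2 / (2 * b) \<le> G b - G a"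
        by linarith
    qed
    then show ?thesis using T by (intro exI[of _ "insert t T"]) (auto simp: card_insert_if)
  qed
qed

lemma greedy_zeros_floor:
  assumes "0 \<le> a" "a \<le> b" "0 < b" "(b - a) * measure \<mu> {a<..b} \<le> M"
  shows "\<exists>T. finite T \<and> card T \<le> nat \<lfloor>sqrt (2 * M)\<rfloor> \<and> controlled_by_zeros T a b"
proof (rule greedy_zeros[OF assms(1-3)])
  have "sqrt (2 * ((b - a) * measure \<mu> {a<..b})) \<le> sqrt (2 * M)"
    using assms(4) by simp
  also have "\<dots> \<le> real (nat \<lfloor>sqrt (2 * M)\<rfloor>) + 1" by linarith
  finally show "sqrt (2 * ((b - a) * measure \<mu> {a<..b})) \<le> real (nat \<lfloor>sqrt (2 * M)\<rfloor>) + 1" .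
qed

section \<open>The half-line\<close>

definition octave_moment :: "nat \<Rightarrow> real" where
  "octave_moment k = (LINT x:{2 ^ k..2 ^ (k + 1)}|\<mu>. \<bar>x\<bar>)"

lemma length_times_measure_le_moment:
  "(2 ^ (k + 1) - 2 ^ k) * measure \<mu> {2 ^ k<..2 ^ (k + 1)} \<le> octave_moment k"
proof -
  let ?I = "{2 ^ k<..2 ^ (k + 1)} :: real set" and ?J = "{2 ^ k..2 ^ (k + 1)} :: real set"
  have c: "continuous_on UNIV (\<lambda>x::real. \<bar>x\<bar>)" by (intro continuous_intros)
  have "(2 ^ (k + 1) - 2 ^ k) * measure \<mu> ?I = (LINT x:?I|\<mu>. 2 ^ k)"
    using emeasure_bounded[of ?I] by (subst set_integral_const) (auto simp: sets_borel)
  also have "\<dots> \<le> (LINT x:?J|\<mu>. \<bar>x\<bar>)"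
    using set_integrable_continuous[OF _ _ c, of ?J]
      set_integrable_continuous[OF _ _ continuous_on_const, of ?I "2 ^ k"]
    unfolding set_lebesgue_integral_def set_integrable_def
    by (intro integral_mono) (auto simp: indicator_def)
  finally show ?thesis by (simp add: octave_moment_def)
qed

text \<open>Each octave step starts from the boundary term that the previous one leaves.  At an octave of
  large moment the boundary term is removed by the zero at its left end.\<close>

lemma half_line:
  assumes "finite {k. octave_moment k > 0.092}"
  obtains T where "finite T"
    and "card T \<le> nat \<lfloor>sqrt (2 * measure \<mu> {0<..1})\<rfloor>
      + (\<Sum>k | octave_moment k > 0.092. 1 + nat \<lfloor>sqrt (2 * octave_moment k)\<rfloor>)"
    and "\<And>m. controlled_by_zeros T 0 (2 ^ m)"
proof -
  define B where "B = {k. octave_moment k > 0.092}"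
  have finB: "finite B" using assms by (simp add: B_def)
  have "\<exists>T. finite T \<and> card T \<le> nat \<lfloor>sqrt (2 * measure \<mu> {0<..1})\<rfloor> \<and> controlled_by_zeros T 0 1"
    by (rule greedy_zeros_floor) auto
  then obtain T0 where T0: "finite T0" "card T0 \<le> nat \<lfloor>sqrt (2 * measure \<mu> {0<..1})\<rfloor>"
    "controlled_by_zeros T0 0 1" by blast
  have "\<forall>k. \<exists>T. finite T \<and> card T \<le> nat \<lfloor>sqrt (2 * octave_moment k)\<rfloor>
      \<and> controlled_by_zeros T (2 ^ k) (2 ^ (k + 1))"
    by (intro allI greedy_zeros_floor length_times_measure_le_moment) auto
  then obtain Tk where Tk: "\<And>k. finite (Tk k)" "\<And>k. card (Tk k) \<le> nat \<lfloor>sqrt (2 * octave_moment k)\<rfloor>"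
    "\<And>k. controlled_by_zeros (Tk k) (2 ^ k) (2 ^ (k + 1))" by metis
  define T where "T = T0 \<union> (\<Union>k\<in>B. insert (2 ^ k) (Tk k))"
  show thesis
  proof
    show "finite T" using T0 Tk finB by (simp add: T_def)
    have "card T \<le> card T0 + (\<Sum>k\<in>B. card (insert (2 ^ k) (Tk k)))"
      unfolding T_def by (rule order_trans[OF card_Un_le add_left_mono[OF card_UN_le[OF finB]]])
    also have "\<dots> \<le> nat \<lfloor>sqrt (2 * measure \<mu> {0<..1})\<rfloor> + (\<Sum>k\<in>B. 1 + nat \<lfloor>sqrt (2 * octave_moment k)\<rfloor>)"
    proof (intro add_mono T0(2) sum_mono)
      fix k
      have "card (insert (2 ^ k) (Tk k)) \<le> 1 + card (Tk k)" using Tk(1) by (simp add: card_insert_if)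
      then show "card (insert (2 ^ k) (Tk k)) \<le> 1 + nat \<lfloor>sqrt (2 * octave_moment k)\<rfloor>"
        using Tk(2)[of k] by linarith
    qed
    finally show "card T \<le> nat \<lfloor>sqrt (2 * measure \<mu> {0<..1})\<rfloor>
      + (\<Sum>k | octave_moment k > 0.092. 1 + nat \<lfloor>sqrt (2 * octave_moment k)\<rfloor>)" by (simp add: B_def)
    show "controlled_by_zeros T 0 (2 ^ m)" for m
    proof (induction m)
      case 0
      then show ?case using T0(3) unfolding controlled_by_zeros_def by (auto simp: T_def)
    next
      case (Suc m)
      show ?case unfolding controlled_by_zeros_def
      proof (intro allI impI)
        fix u G assume u: "continuous_on UNIV u" and G: "energy_bound u G" and u0: "u 0 = 0"
          and zero: "\<forall>t\<in>T. u t = 0"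
        let ?a = "2 ^ m :: real"
        let ?F = "\<lambda>a b. LINT x:{a<..b}|\<mu>. (cmod (u x))\<^sup>2"
        have IH: "?F 0 ?a + (cmod (u ?a))\<^sup>2 / (2 * ?a) \<le> G ?a - G 0"
          using Suc.IH u G u0 zero unfolding controlled_by_zeros_def by blast
        have split: "?F 0 (2 * ?a) = ?F 0 ?a + ?F ?a (2 * ?a)"
          using u by (intro set_integral_split continuous_intros) auto
        have step: "?F ?a (2 * ?a) + (cmod (u (2 * ?a)))\<^sup>2 / (4 * ?a)
            \<le> G (2 * ?a) - G ?a + (cmod (u ?a))\<^sup>2 / (2 * ?a)"
        proof (cases "m \<in> B")
          case True
          then have "u ?a = 0" "\<forall>t\<in>Tk m. u t = 0" using zero by (auto simp: T_def)
          then have "?F ?a (2 ^ (m + 1)) + (cmod (u (2 ^ (m + 1))))\<^sup>2 / (2 * 2 ^ (m + 1)) \<le> G (2 ^ (m + 1)) - G ?a"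
            using Tk(3)[of m] u G unfolding controlled_by_zeros_def by blast
          then show ?thesis using \<open>u ?a = 0\<close> by simp
        next
          case False
          then have "(LINT x:{?a..2 * ?a}|\<mu>. \<bar>x\<bar>) \<le> 1 / 6"
            by (simp add: B_def octave_moment_def)
          then show ?thesis by (intro octave_small[OF u G]) auto
        qed
        show "?F 0 (2 ^ Suc m) + (cmod (u (2 ^ Suc m)))\<^sup>2 / (2 * 2 ^ Suc m) \<le> G (2 ^ Suc m) - G 0"
          using IH split step by simp
      qed
    qed
  qed
qed

end

section \<open>Both half-lines\<close>

lemma radon_locally_finite: "radon_measure \<nu> \<Longrightarrow> locally_finite_measure \<nu>"
  by (simp add: radon_measure_def locally_finite_measure_def)

abbreviation reflected :: "real measure \<Rightarrow> real measure" where
  "reflected \<nu> \<equiv> distr \<nu> borel uminus"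

lemma uminus_measurable:
  assumes "locally_finite_measure \<nu>" shows "(uminus :: real \<Rightarrow> real) \<in> measurable \<nu> borel"
proof -
  have "measurable \<nu> (borel :: real measure) = measurable borel borel"
    by (rule measurable_cong_sets[OF locally_finite_measure.sets_borel[OF assms] refl])
  then show ?thesis by (simp add: borel_measurable_continuous_onI continuous_on_minus)
qed

lemma locally_finite_reflected:
  assumes "locally_finite_measure \<nu>" shows "locally_finite_measure (reflected \<nu>)"
proof -
  interpret locally_finite_measure \<nu> by fact
  have vimage: "uminus -` S = uminus ` S" for S :: "real set"
    by (rule set_eqI) (metis image_iff minus_minus vimage_eq)
  show ?thesis
  proof
    fix K :: "real set" assume K: "compact K"
    have "emeasure (reflected \<nu>) K = emeasure \<nu> (uminus ` K)"
      using K sets_eq_imp_space_eq[OF sets_borel]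
      by (subst emeasure_distr[OF uminus_measurable[OF assms]]) (auto simp: vimage compact_imp_closed)
    also have "\<dots> < \<infinity>"
      using K by (intro finite_compact compact_continuous_image continuous_intros)
    finally show "emeasure (reflected \<nu>) K < \<infinity>" .
  qed simp
qed

lemma set_integral_reflected:
  fixes f :: "real \<Rightarrow> real"
  assumes "locally_finite_measure \<nu>" "S \<in> sets borel" "f \<in> borel_measurable borel"
  shows "(LINT x:S|reflected \<nu>. f x) = (LINT x:uminus ` S|\<nu>. f (- x))"
proof -
  have ind: "indicator S (- x) = (indicator (uminus ` S) x :: real)" for x
  proof -
    have "- x \<in> S \<longleftrightarrow> x \<in> uminus ` S" by (metis image_iff minus_minus)
    then show ?thesis by (simp add: indicator_def)
  qed
  show ?thesis
    unfolding set_lebesgue_integral_def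
    by (subst integral_distr[OF uminus_measurable[OF assms(1)]]) (use assms in \<open>auto simp: ind\<close>)
qed

lemma octave_moment_eq:
  assumes "locally_finite_measure \<nu>"
  shows "\<A> \<nu> (int k + 1) = locally_finite_measure.octave_moment \<nu> k"
    and "\<A> \<nu> (- (int k + 1)) = locally_finite_measure.octave_moment (reflected \<nu>) k"
proof -
  note lf = locally_finite_reflected[OF assms]
  have p: "(2::real) powi (int k + 1) = 2 ^ (k + 1)"
    using power_int_of_nat[of "2::real" "k + 1"] by (simp add: add.commute)
  show "\<A> \<nu> (int k + 1) = locally_finite_measure.octave_moment \<nu> k"
    unfolding \<A>_def dyadic_def locally_finite_measure.octave_moment_def[OF assms] using p by simp
  have "\<bar>- (int k + 1)\<bar> = int k + 1" by simp
  then have "\<A> \<nu> (- (int k + 1)) = (LINT x:{- (2 ^ (k + 1))..- (2 ^ k)}|\<nu>. \<bar>x\<bar>)"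
    unfolding \<A>_def dyadic_def using p by (simp add: add.commute[of 1])
  also have "{- (2 ^ (k + 1))..- (2 ^ k)} = uminus ` {2 ^ k..2 ^ (k + 1) :: real}" by simp
  also have "(LINT x:\<dots>|\<nu>. \<bar>x\<bar>) = (LINT x:\<dots>|\<nu>. \<bar>- x\<bar>)" by simp
  also have "\<dots> = locally_finite_measure.octave_moment (reflected \<nu>) k"
    unfolding locally_finite_measure.octave_moment_def[OF lf]
    by (rule set_integral_reflected[OF assms, symmetric]) auto
  finally show "\<A> \<nu> (- (int k + 1)) = locally_finite_measure.octave_moment (reflected \<nu>) k" .
qed

lemma energy_bound_reflected:
  assumes "energy_bound u G" shows "energy_bound (\<lambda>x. u (- x)) (\<lambda>x. - G (- x))"
  unfolding energy_bound_def
proof (intro allI impI)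
  fix x y :: real assume "x \<le> y"
  then have "(cmod (u (- x) - u (- y)))\<^sup>2 \<le> (- x - - y) * (G (- x) - G (- y))"
    by (intro energy_boundD[OF assms]) simp
  then show "(cmod (u (- y) - u (- x)))\<^sup>2 \<le> (y - x) * (- G (- y) - - G (- x))"
    by (simp add: norm_minus_commute)
qed

text \<open>Both half-lines are estimated up to \<open>2 ^ m\<close>, and \<open>m\<close> tends to infinity.  The point \<open>0\<close> is in
  neither half-open half-line, but \<open>u\<close> vanishes there.\<close>

lemma form_nonneg:
  assumes lf: "locally_finite_measure \<nu>"
    and right: "\<And>m. locally_finite_measure.controlled_by_zeros \<nu> T 0 (2 ^ m)"
    and left: "\<And>m. locally_finite_measure.controlled_by_zeros (reflected \<nu>) T' 0 (2 ^ m)"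
    and u: "u \<in> form_dom \<nu>" and zero: "u 0 = 0" "\<And>t. t \<in> T \<Longrightarrow> u t = 0" "\<And>t. t \<in> T' \<Longrightarrow> u (- t) = 0"
  shows "0 \<le> form \<nu> u"
proof -
  interpret locally_finite_measure \<nu> by fact
  interpret refl: locally_finite_measure "reflected \<nu>" using lf by (rule locally_finite_reflected)
  define D where "D = (LINT x|lborel. (cmod (weak_deriv u x))\<^sup>2)"
  have uW: "u \<in> W12" and u2: "integrable \<nu> (\<lambda>x. (cmod (u x))\<^sup>2)"
    using u by (auto simp: form_dom_def L2_def)
  have cont: "continuous_on UNIV u" using uW by (simp add: W12_def)
  have cont': "continuous_on UNIV (\<lambda>x. u (- x))"
    by (rule continuous_on_compose2[OF cont]) (auto intro: continuous_intros)
  have c2: "continuous_on UNIV (\<lambda>x. (cmod (u x))\<^sup>2)" using cont by (intro continuous_intros)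
  have c2': "continuous_on UNIV (\<lambda>x. (cmod (u (- x)))\<^sup>2)" using cont' by (intro continuous_intros)
  obtain G where G: "energy_bound u G" and GD: "\<And>x y. G y - G x \<le> D"
    using W12_energy[OF uW] unfolding D_def by blast
  have bound: "(LINT x:{- (2 ^ m)..2 ^ m}|\<nu>. (cmod (u x))\<^sup>2) \<le> D" for m :: nat
  proof -
    let ?b = "2 ^ m :: real"
    have "(LINT x:{0<..?b}|\<nu>. (cmod (u x))\<^sup>2) + (cmod (u ?b))\<^sup>2 / (2 * ?b) \<le> G ?b - G 0"
      using right[of m] cont G zero unfolding controlled_by_zeros_def by blast
    moreover have "0 \<le> (cmod (u ?b))\<^sup>2 / (2 * ?b)" by simp
    ultimately have R: "(LINT x:{0<..?b}|\<nu>. (cmod (u x))\<^sup>2) \<le> G ?b - G 0" by linarith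
    have "(LINT x:{0<..?b}|reflected \<nu>. (cmod (u (- x)))\<^sup>2) + (cmod (u (- ?b)))\<^sup>2 / (2 * ?b)
        \<le> - G (- ?b) - - G (- 0)"
      by (rule left[of m, unfolded refl.controlled_by_zeros_def, rule_format,
            OF cont' energy_bound_reflected[OF G]]) (use zero in auto)
    moreover have "0 \<le> (cmod (u (- ?b)))\<^sup>2 / (2 * ?b)" by simp
    moreover have "- G (- ?b) - - G (- 0) = G 0 - G (- ?b)" by simp
    ultimately have "(LINT x:{0<..?b}|reflected \<nu>. (cmod (u (- x)))\<^sup>2) \<le> G 0 - G (- ?b)"
      by linarith
    also have "(LINT x:{0<..?b}|reflected \<nu>. (cmod (u (- x)))\<^sup>2) = (LINT x:{- ?b..<0}|\<nu>. (cmod (u x))\<^sup>2)"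
      using set_integral_reflected[OF lf, of "{0<..?b}" "\<lambda>x. (cmod (u (- x)))\<^sup>2"]
        borel_measurable_continuous_onI[OF c2'] by simp
    finally have L: "(LINT x:{- ?b..<0}|\<nu>. (cmod (u x))\<^sup>2) \<le> G 0 - G (- ?b)" .
    have "(LINT x:{- ?b..?b}|\<nu>. (cmod (u x))\<^sup>2) = (LINT x:{- ?b..<0} \<union> {0<..?b}|\<nu>. (cmod (u x))\<^sup>2)"
      unfolding set_lebesgue_integral_def
      by (rule Bochner_Integration.integral_cong)
         (use zero(1) in \<open>auto simp: indicator_def not_le not_less intro!: order_antisym\<close>)
    also have "\<dots> = (LINT x:{- ?b..<0}|\<nu>. (cmod (u x))\<^sup>2) + (LINT x:{0<..?b}|\<nu>. (cmod (u x))\<^sup>2)"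
      by (intro set_integral_Un set_integrable_continuous c2) auto
    also have "\<dots> \<le> D" using L R GD[of ?b "- ?b"] by linarith
    finally show ?thesis .
  qed
  have "(\<lambda>m. LINT x:{- (2 ^ m)..2 ^ m}|\<nu>. (cmod (u x))\<^sup>2) \<longlonglongrightarrow> (LINT x|\<nu>. (cmod (u x))\<^sup>2)"
    unfolding set_lebesgue_integral_def
  proof (rule integral_dominated_convergence)
    show "integrable \<nu> (\<lambda>x. (cmod (u x))\<^sup>2)" by (rule u2)
    show "(\<lambda>x. (cmod (u x))\<^sup>2) \<in> borel_measurable \<nu>" using u2 by (rule borel_measurable_integrable)
    then show "(\<lambda>x. indicator {- (2 ^ m)..2 ^ m} x *\<^sub>R (cmod (u x))\<^sup>2) \<in> borel_measurable \<nu>" for m :: nat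
      by (intro borel_measurable_scaleR borel_measurable_indicator) (auto simp: sets_borel)
    show "AE x in \<nu>. norm (indicator {- (2 ^ m)..2 ^ m} x *\<^sub>R (cmod (u x))\<^sup>2) \<le> (cmod (u x))\<^sup>2" for m :: nat
      by (intro AE_I2) (simp add: indicator_def)
    show "AE x in \<nu>. (\<lambda>m. indicator {- (2 ^ m)..2 ^ m} x *\<^sub>R (cmod (u x))\<^sup>2) \<longlonglongrightarrow> (cmod (u x))\<^sup>2"
    proof (intro AE_I2 tendsto_eventually)
      fix x :: real
      obtain N where N: "\<bar>x\<bar> < 2 ^ N" using real_arch_pow[of 2 "\<bar>x\<bar>"] by auto
      have "x \<in> {- (2 ^ m)..2 ^ m}" if "N \<le> m" for m :: nat
      proof -
        have "(2::real) ^ N \<le> 2 ^ m" using that by (intro power_increasing) auto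
        then have "\<bar>x\<bar> \<le> 2 ^ m" using N by linarith
        then show ?thesis by (auto simp: abs_le_iff)
      qed
      then show "\<forall>\<^sub>F m in sequentially. indicator {- (2 ^ m)..2 ^ m} x *\<^sub>R (cmod (u x))\<^sup>2 = (cmod (u x))\<^sup>2"
        by (auto simp: eventually_sequentially intro!: exI[of _ N])
    qed
  qed
  then have "(LINT x|\<nu>. (cmod (u x))\<^sup>2) \<le> D"
    by (rule LIMSEQ_le_const2) (use bound in auto)
  then show ?thesis by (simp add: form_def D_def)
qed

section \<open>The number of points\<close>

text \<open>The summand \<open>1\<close> is absorbed by the threshold: \<open>sqrt A \<ge> 3/10\<close> and
  \<open>(5.06 - 1.42) * 3/10 \<ge> 1\<close>.\<close>

lemma count_outer:
  assumes "(A::real) > 0.092" shows "1 + real (nat \<lfloor>sqrt (2 * A)\<rfloor>) \<le> 5.06 * sqrt A"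
proof -
  have s: "3 / 10 \<le> sqrt A" using assms by (intro real_le_rsqrt) (simp add: power2_eq_square)
  have "sqrt 2 \<le> (71 / 50 :: real)" by (rule real_le_lsqrt) (simp_all add: power2_eq_square)
  then have "sqrt (2 * A) \<le> 71 / 50 * sqrt A"
    unfolding real_sqrt_mult using assms by (intro mult_right_mono) auto
  moreover have "real (nat \<lfloor>sqrt (2 * A)\<rfloor>) \<le> sqrt (2 * A)" using assms by simp
  ultimately have "1 + real (nat \<lfloor>sqrt (2 * A)\<rfloor>) \<le> 253 / 50 * sqrt A" using s by linarith
  then show ?thesis by simp
qed

text \<open>For \<open>A \<le> 0.092\<close> both square roots are below \<open>1\<close>, so their floors vanish and the central interval
  costs nothing.\<close>

lemma count_centre:
  assumes "(p::real) \<ge> 0" "q \<ge> 0" "p + q \<le> A"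
  shows "real (nat \<lfloor>sqrt (2 * p)\<rfloor> + nat \<lfloor>sqrt (2 * q)\<rfloor>) \<le> (if A > 0.092 then 5.06 * sqrt A else 0)"
proof (cases "A > 0.092")
  case True
  have le: "real (nat \<lfloor>sqrt (2 * r)\<rfloor>) \<le> sqrt 4 * sqrt A" if "0 \<le> r" "r \<le> A" for r
  proof -
    have "real (nat \<lfloor>sqrt (2 * r)\<rfloor>) \<le> sqrt (2 * r)" using that by simp
    also have "\<dots> \<le> sqrt (4 * A)" using that by (intro real_sqrt_le_mono) auto
    finally show ?thesis by (simp add: real_sqrt_mult)
  qed
  have "real (nat \<lfloor>sqrt (2 * p)\<rfloor> + nat \<lfloor>sqrt (2 * q)\<rfloor>) \<le> 2 * sqrt A + 2 * sqrt A"
    using le[of p] le[of q] assms by simp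
  also have "\<dots> \<le> 5.06 * sqrt A" using True by simp
  finally show ?thesis using True by simp
next
  case False
  have "sqrt (2 * r) < 1" if "0 \<le> r" "r \<le> A" for r using that False by simp
  then have "\<lfloor>sqrt (2 * r)\<rfloor> \<le> 0" if "0 \<le> r" "r \<le> A" for r
    using that by (simp add: floor_le_iff)
  then show ?thesis using assms False by simp
qed

lemma infsum_ennreal_bounded_below:
  fixes f :: "'a \<Rightarrow> ennreal"
  assumes "infinite S" and c: "0 < c" "\<And>x. x \<in> S \<Longrightarrow> ennreal c \<le> f x"
  shows "infsum f S = \<infinity>"
proof -
  have "of_nat n * ennreal c \<le> infsum f S" for n
  proof -
    obtain F where F: "finite F" "card F = n" "F \<subseteq> S"
      using infinite_arbitrarily_large[OF assms(1)] by blast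
    have "of_nat n * ennreal c = (\<Sum>x\<in>F. ennreal c)" by (simp add: F)
    also have "\<dots> \<le> sum f F" using F c by (intro sum_mono) auto
    also have "\<dots> = infsum f F" using F by simp
    also have "\<dots> \<le> infsum f S"
      using F by (intro infsum_mono_neutral nonneg_summable_on_complete) auto
    finally show ?thesis .
  qed
  then have "(SUP n. of_nat n * ennreal c) \<le> infsum f S" by (intro SUP_least)
  moreover have "(SUP n. of_nat n * ennreal c) = (SUP n. of_nat n) * ennreal c"
    by (rule SUP_mult_right_ennreal[symmetric])
  moreover have "\<dots> = \<infinity>"
    using c by (simp only: ennreal_SUP_of_nat_eq_top) (simp add: ennreal_top_mult)
  ultimately show ?thesis by (simp add: top_unique)
qed

theorem mainTheorem4:
  fixes \<nu> :: "real measure"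
  assumes "sigma_finite_measure \<nu>" and "radon_measure \<nu>"
  shows "ennreal_of_enat (N_minus (form_dom \<nu>) (form \<nu>))
    \<le> 1 + ennreal 5.06 * (\<Sum>\<^sub>\<infinity>n\<in>{n::int. \<A> \<nu> n > 0.092}. ennreal (sqrt (\<A> \<nu> n)))"
proof (cases "finite {n::int. \<A> \<nu> n > 0.092}")
  case False
  have "ennreal (sqrt 0.092) \<le> ennreal (sqrt (\<A> \<nu> n))" if "n \<in> {n. \<A> \<nu> n > 0.092}" for n
    using that by (intro ennreal_leI real_sqrt_le_mono) simp
  then have "(\<Sum>\<^sub>\<infinity>n\<in>{n::int. \<A> \<nu> n > 0.092}. ennreal (sqrt (\<A> \<nu> n))) = \<infinity>"
    by (intro infsum_ennreal_bounded_below[OF False, where c = "sqrt 0.092"]) auto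
  then show ?thesis by (simp add: ennreal_mult_top)
next
  case True
  have lf: "locally_finite_measure \<nu>" using assms(2) by (rule radon_locally_finite)
  interpret locally_finite_measure \<nu> by fact
  interpret refl: locally_finite_measure "reflected \<nu>" using lf by (rule locally_finite_reflected)
  define P where "P = {k. octave_moment k > 0.092}"
  define M where "M = {k. refl.octave_moment k > 0.092}"
  define pos where "pos k = int k + 1" for k
  define neg where "neg k = - (int k + 1)" for k
  have inj: "inj_on pos P" "inj_on neg M" by (auto simp: inj_on_def pos_def neg_def)
  have Apos: "\<A> \<nu> (pos k) = octave_moment k" for k
    unfolding pos_def by (rule octave_moment_eq(1)[OF lf])
  have Aneg: "\<A> \<nu> (neg k) = refl.octave_moment k" for k
    unfolding neg_def by (rule octave_moment_eq(2)[OF lf])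
  have sub: "pos ` P \<subseteq> {n. \<A> \<nu> n > 0.092}" "neg ` M \<subseteq> {n. \<A> \<nu> n > 0.092}"
    by (auto simp: P_def M_def Apos Aneg)
  have finP: "finite P" and finM: "finite M"
    using finite_subset[OF sub(1) True] finite_subset[OF sub(2) True] inj by (auto dest: finite_imageD)
  obtain T where T: "finite T" "card T \<le> nat \<lfloor>sqrt (2 * measure \<nu> {0<..1})\<rfloor>
      + (\<Sum>k\<in>P. 1 + nat \<lfloor>sqrt (2 * octave_moment k)\<rfloor>)" "\<And>m. controlled_by_zeros T 0 (2 ^ m)"
    using half_line finP unfolding P_def by blast
  obtain T' where T': "finite T'" "card T' \<le> nat \<lfloor>sqrt (2 * measure (reflected \<nu>) {0<..1})\<rfloor>
      + (\<Sum>k\<in>M. 1 + nat \<lfloor>sqrt (2 * refl.octave_moment k)\<rfloor>)" "\<And>m. refl.controlled_by_zeros T' 0 (2 ^ m)"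
    using refl.half_line finM unfolding M_def by blast
  define Z where "Z = insert 0 (T \<union> uminus ` T')"
  have "N_minus (form_dom \<nu>) (form \<nu>) \<le> enat (card Z)"
  proof (rule N_minus_le_card)
    show "finite Z" using T T' by (simp add: Z_def)
    show "0 \<le> form \<nu> u" if "u \<in> form_dom \<nu>" "\<And>t. t \<in> Z \<Longrightarrow> u t = 0" for u
      by (rule form_nonneg[OF lf T(3) T'(3) that(1)]) (use that(2) in \<open>auto simp: Z_def\<close>)
  qed
  then have N: "ennreal_of_enat (N_minus (form_dom \<nu>) (form \<nu>)) \<le> ennreal (real (card Z))"
    using ennreal_of_enat_le_iff[of _ "enat (card Z)"] by (simp add: ennreal_of_nat_eq_real_of_nat)
  define p where "p = measure \<nu> {0<..1}"
  define q where "q = measure (reflected \<nu>) {0<..1}"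
  have pq: "p + q \<le> \<A> \<nu> 0"
  proof -
    have "q = measure \<nu> {-1..<0}"
    proof -
      have "uminus -` {0<..1} = {-1..<0::real}" by auto
      then show ?thesis
        unfolding q_def using sets_eq_imp_space_eq[OF sets_borel]
        by (subst measure_distr[OF uminus_measurable[OF lf]]) auto
    qed
    moreover have fin: "emeasure \<nu> S \<noteq> \<infinity>" if "S \<in> sets borel" "S \<subseteq> {-1..1}" for S
      using emeasure_bounded[of S] that bounded_subset[of "{-1..1}" S] by auto
    moreover have "emeasure \<nu> {0<..1} \<noteq> \<infinity>" "emeasure \<nu> {-1..<0} \<noteq> \<infinity>"
      by (rule fin; auto)+
    ultimately have "p + q = measure \<nu> ({0<..1} \<union> {-1..<0})"
      unfolding p_def by (subst measure_Union) (auto simp: sets_borel)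
    also have "\<dots> \<le> measure \<nu> {-1..1}"
      using fin[of "{-1..1}"]
      by (intro measure_mono_fmeasurable) (auto simp: sets_borel fmeasurable_def less_top)
    also have "\<dots> = \<A> \<nu> 0"
      unfolding \<A>_def dyadic_def using fin[of "{-1..1}"]
      by (simp add: set_integral_const sets_borel)
    finally show ?thesis .
  qed
  let ?s = "\<lambda>n. sqrt (\<A> \<nu> n)"
  define C where "C = (if \<A> \<nu> 0 > 0.092 then {0::int} else {})"
  have union: "{n. \<A> \<nu> n > 0.092} = (pos ` P \<union> neg ` M) \<union> C"
  proof (intro equalityI subsetI)
    fix n assume n: "n \<in> {n. \<A> \<nu> n > 0.092}"
    consider "n = 0" | "n = pos (nat (n - 1))" | "n = neg (nat (- n - 1))"
      unfolding pos_def neg_def by linarith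
    then show "n \<in> (pos ` P \<union> neg ` M) \<union> C"
    proof cases
      case 1
      then show ?thesis using n by (simp add: C_def)
    next
      case 2
      then have "nat (n - 1) \<in> P" using n Apos[of "nat (n - 1)"] by (simp add: P_def)
      then show ?thesis using 2 by blast
    next
      case 3
      then have "nat (- n - 1) \<in> M" using n Aneg[of "nat (- n - 1)"] by (simp add: M_def)
      then show ?thesis using 3 by blast
    qed
  next
    fix n assume "n \<in> (pos ` P \<union> neg ` M) \<union> C"
    then show "n \<in> {n. \<A> \<nu> n > 0.092}" using sub by (auto simp: C_def split: if_splits)
  qed
  have total: "(\<Sum>n | \<A> \<nu> n > 0.092. ?s n) = (\<Sum>k\<in>P. ?s (pos k)) + (\<Sum>k\<in>M. ?s (neg k)) + sum ?s C"
  proof -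
    have "sum ?s ((pos ` P \<union> neg ` M) \<union> C) = sum ?s (pos ` P) + sum ?s (neg ` M) + sum ?s C"
      using finP finM
      by (subst sum.union_disjoint; (subst sum.union_disjoint)?) (auto simp: C_def pos_def neg_def)
    then show ?thesis unfolding union by (simp add: sum.reindex inj)
  qed
  have "real (card Z) \<le> 1 + (real (card T) + real (card T'))"
  proof -
    have "card Z \<le> 1 + card (T \<union> uminus ` T')" using T T' by (simp add: Z_def card_insert_if)
    also have "card (T \<union> uminus ` T') \<le> card T + card (uminus ` T')" by (rule card_Un_le)
    also have "card (uminus ` T') \<le> card T'" using T'(1) by (rule card_image_le)
    finally show ?thesis by simp
  qed
  also have "\<dots> \<le> 1 + (real (nat \<lfloor>sqrt (2 * p)\<rfloor> + nat \<lfloor>sqrt (2 * q)\<rfloor>)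
      + (\<Sum>k\<in>P. 1 + real (nat \<lfloor>sqrt (2 * octave_moment k)\<rfloor>))
      + (\<Sum>k\<in>M. 1 + real (nat \<lfloor>sqrt (2 * refl.octave_moment k)\<rfloor>)))"
    using T(2)[folded p_def, THEN of_nat_mono[where 'a = real]]
      T'(2)[folded q_def, THEN of_nat_mono[where 'a = real]] by simp
  also have "\<dots> \<le> 1 + (5.06 * sum ?s C + (\<Sum>k\<in>P. 5.06 * ?s (pos k)) + (\<Sum>k\<in>M. 5.06 * ?s (neg k)))"
  proof (intro add_left_mono add_mono sum_mono)
    show "real (nat \<lfloor>sqrt (2 * p)\<rfloor> + nat \<lfloor>sqrt (2 * q)\<rfloor>) \<le> 5.06 * sum ?s C"
      using count_centre[OF _ _ pq] by (simp add: C_def p_def q_def split: if_splits)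
    show "1 + real (nat \<lfloor>sqrt (2 * octave_moment k)\<rfloor>) \<le> 5.06 * ?s (pos k)" if "k \<in> P" for k
      unfolding Apos using that by (intro count_outer) (simp add: P_def)
    show "1 + real (nat \<lfloor>sqrt (2 * refl.octave_moment k)\<rfloor>) \<le> 5.06 * ?s (neg k)" if "k \<in> M" for k
      unfolding Aneg using that by (intro count_outer) (simp add: M_def)
  qed
  also have "\<dots> = 1 + 5.06 * (\<Sum>n | \<A> \<nu> n > 0.092. ?s n)"
    unfolding total sum_distrib_left[symmetric] by (simp add: algebra_simps)
  finally have "ennreal (real (card Z)) \<le> ennreal (1 + 5.06 * (\<Sum>n | \<A> \<nu> n > 0.092. ?s n))"
    by (rule ennreal_leI)
  also have "\<dots> = 1 + ennreal 5.06 * ennreal (\<Sum>n | \<A> \<nu> n > 0.092. ?s n)"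
  proof -
    have W: "0 \<le> (\<Sum>n | \<A> \<nu> n > 0.092. ?s n)" by (rule sum_nonneg) simp
    then have "ennreal (1 + 5.06 * (\<Sum>n | \<A> \<nu> n > 0.092. ?s n))
        = ennreal 1 + ennreal (5.06 * (\<Sum>n | \<A> \<nu> n > 0.092. ?s n))"
      by (intro ennreal_plus mult_nonneg_nonneg) auto
    also have "ennreal (5.06 * (\<Sum>n | \<A> \<nu> n > 0.092. ?s n))
        = ennreal 5.06 * ennreal (\<Sum>n | \<A> \<nu> n > 0.092. ?s n)"
      using W by (intro ennreal_mult) auto
    finally show ?thesis by (simp only: ennreal_1)
  qed
  also have "ennreal (\<Sum>n | \<A> \<nu> n > 0.092. ?s n) = (\<Sum>n | \<A> \<nu> n > 0.092. ennreal (?s n))"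
    by (rule sum_ennreal[symmetric]) auto
  also have "\<dots> = (\<Sum>\<^sub>\<infinity>n\<in>{n. \<A> \<nu> n > 0.092}. ennreal (?s n))"
    using True by simp
  finally show ?thesis using N by (rule order_trans[rotated])
qed

end
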